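(* Let $H:[1,+\infty)\to[1,+\infty)$ be a non-decreasing function. Then $H$ is a universal upper-class normalization if and only if $$\sum_{r\geq 1}\frac{2^r r^2}{H(2^r)^2}<+\infty .$$ Moreover, if this series diverges, then the failure of $H$ to be a universal upper-class normalization is witnessed by an admissible system $(X,\Omega,\mu,\mathbf F,\mathbf f,\mathbf g)$ with $X=[0,1]$, $\Omega$ the Borel $\sigma$-algebra of $[0,1]$, $\mu$ the Lebesgue measure on $[0,1]$, $f_k=1/2$ and $g_k=1$ for all $k\in\mathbb N$, which also satisfies all of the following: (i) for any $k\in\mathbb N$, $0\le F_k\le 1$ and $f_k=\int_X F_k(x)\,\mu(\mathrm dx)$; (ii) there exists $K>0$ such that for any $m,n\in\mathbb N$ with $m<n$, $$\int_X\Bigl(\sum_{m<k\le n}(F_k(x)-f_k)\Bigr)^2\,\mu(\mathrm dx)=K(n-m);$$ (iii) for $\mu$-almost every $x\in[0,1]$, $$\limsup_{N\to\infty}\frac{|D_N(x)|}{H(\Phi(N)+1)+\max_{k\le N}f_k+1}=+\infty .$$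
   Context: $\mathbb N=\{1,2,3,\dots\}$. Admissible system. Let $(X,\Omega,\mu)$ be a finite measure space with $0<\mu(X)<+\infty$, let $\mathbf F=(F_k)_{k\in\mathbb N}$ be a sequence of non-negative real-valued $\Omega$-measurable functions on $X$, and let $\mathbf f=(f_k)_{k\in\mathbb N}$, $\mathbf g=(g_k)_{k\in\mathbb N}$ be sequences of non-negative real numbers. For $N\in\mathbb N$ put $$\Phi(N)=\sum_{k=1}^N g_k,\qquad D_N(x)=\sum_{k=1}^N\bigl(F_k(x)-f_k\bigr)\quad(x\in X).$$ The sextuple $(X,\Omega,\mu,\mathbf F,\mathbf f,\mathbf g)$ is an admissible system if: (a) $0\le f_k\le g_k$ for all $k\in\mathbb N$; (b) $\lim_{N\to\infty}\Phi(N)=+\infty$; (c) there exists $K>0$ such that for any $m,n\in\mathbb N$ with $m<n$, $$\int_X\bigl(D_n(x)-D_m(x)\bigr)^2\,\mu(\mathrm dx)\le K\bigl(\Phi(n)-\Phi(m)\bigr).$$ Universal upper-class normalization. A non-decreasing function $H:[1,+\infty)\to[1,+\infty)$ is a universal upper-class normalization if for any admissible system $(X,\Omega,\mu,\mathbf F,\mathbf f,\mathbf g)$ and for $\mu$-almost every $x\in X$, as $N\to+\infty$, $$D_N(x)=O_x\Bigl(H(\Phi(N)+1)+\max_{k\le N}f_k+1\Bigr).$$ The exceptional null set may depend on the admissible system, and the implied constant may depend on both the admissible system and the point $x$. *)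

theory Defs
  imports "HOL-Analysis.Analysis" "HOL-Library.Landau_Symbols"
begin

text \<open>
  Sequences indexed by the positive integers are functions on \<^typ>\<open>nat\<close> whose value at \<open>0\<close> is
  never used.
\<close>

definition Phi :: "(nat \<Rightarrow> real) \<Rightarrow> nat \<Rightarrow> real" where
  "Phi g N = (\<Sum>k=1..N. g k)"

definition Disc :: "(nat \<Rightarrow> 'a \<Rightarrow> real) \<Rightarrow> (nat \<Rightarrow> real) \<Rightarrow> nat \<Rightarrow> 'a \<Rightarrow> real" where
  "Disc F f N x = (\<Sum>k=1..N. (F k x - f k))"

text \<open>
  The variance bound uses the non-negative integral: the Bochner integral of a non-integrable
  function is \<open>0\<close>, which would make the bound vacuous for such functions.
\<close>

locale admissible_system = finite_measure M
  for M :: "'a measure"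
  and F :: "nat \<Rightarrow> 'a \<Rightarrow> real"
  and f g :: "nat \<Rightarrow> real" +
  assumes space_pos: "0 < emeasure M (space M)"
    and F_measurable: "\<And>k. 1 \<le> k \<Longrightarrow> F k \<in> borel_measurable M"
    and F_nonneg: "\<And>k x. 1 \<le> k \<Longrightarrow> x \<in> space M \<Longrightarrow> 0 \<le> F k x"
    and f_nonneg: "\<And>k. 1 \<le> k \<Longrightarrow> 0 \<le> f k"
    and f_le_g: "\<And>k. 1 \<le> k \<Longrightarrow> f k \<le> g k"
    and Phi_at_top: "filterlim (Phi g) at_top sequentially"
    and variance_bound: "\<exists>K>0. \<forall>m n. 1 \<le> m \<and> m < n \<longrightarrow>
      (\<integral>\<^sup>+ x. ennreal ((Disc F f n x - Disc F f m x)\<^sup>2) \<partial>M) \<le> ennreal (K * (Phi g n - Phi g m))"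

text \<open>For \<open>N = 0\<close> the maximum is unspecified; only the behaviour as \<open>N\<close> tends to infinity matters.\<close>

definition upper_bound_term ::
    "(real \<Rightarrow> real) \<Rightarrow> (nat \<Rightarrow> real) \<Rightarrow> (nat \<Rightarrow> real) \<Rightarrow> nat \<Rightarrow> real" where
  "upper_bound_term H f g N = H (Phi g N + 1) + Max (f ` {1..N}) + 1"

definition upper_class_for ::
    "(real \<Rightarrow> real) \<Rightarrow> 'a measure \<Rightarrow> (nat \<Rightarrow> 'a \<Rightarrow> real) \<Rightarrow> (nat \<Rightarrow> real) \<Rightarrow> (nat \<Rightarrow> real) \<Rightarrow> bool" where
  "upper_class_for H M F f g \<longleftrightarrow>
     (AE x in M. (\<lambda>N. Disc F f N x) \<in> O(\<lambda>N. upper_bound_term H f g N))"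

text \<open>
  A non-decreasing function from \<open>[1,\<infinity>)\<close> to itself is represented by a function on the reals
  constrained on \<open>{1..}\<close> only.
\<close>

definition normalization :: "(real \<Rightarrow> real) \<Rightarrow> bool" where
  "normalization H \<longleftrightarrow> H \<in> {1..} \<rightarrow> {1..} \<and> mono_on {1..} H"

text \<open>
  HOL cannot quantify over types inside a formula, so the type of the points of the measure spaces
  is a parameter; being a universal upper-class normalization means that this holds for all types.
\<close>

definition universal_upper_class :: "'a itself \<Rightarrow> (real \<Rightarrow> real) \<Rightarrow> bool" where
  "universal_upper_class T H \<longleftrightarrow> normalization H \<and>
     (\<forall>(M :: 'a measure) F f g. admissible_system M F f g \<longrightarrow> upper_class_for H M F f g)"

text \<open>The term for \<open>r = 0\<close> is \<open>0\<close>, so this is the series over \<open>r \<ge> 1\<close>.\<close>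

definition normalization_series_converges :: "(real \<Rightarrow> real) \<Rightarrow> bool" where
  "normalization_series_converges H \<longleftrightarrow>
     summable (\<lambda>r::nat. 2 ^ r * (real r)\<^sup>2 / (H (2 ^ r))\<^sup>2)"

abbreviation unit_interval :: "real measure" where
  "unit_interval \<equiv> restrict_space lborel {0..1}"

end

theory Submission
  imports Defs "HOL-Library.Discrete_Functions"
begin

text \<open>
  Convergence of the series suffices by a Rademacher--Menshov argument carried out on the scale of
  \<open>\<Phi>\<close> rather than on the scale of the index. For an integer \<open>j\<close> let \<open>q j\<close> be the last index at which
  \<open>\<Phi>\<close> is below \<open>j\<close>. Since the partial sums of the \<open>F k\<close> increase, \<open>D N\<close> is squeezed between the
  values of \<open>D\<close> at two consecutive points \<open>q j\<close> and \<open>q (j + 1)\<close>, up to one jump \<open>f k\<close> and an error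
  \<open>1\<close> (\<open>Disc_between_last_below\<close>); however many indices a unit of \<open>\<Phi>\<close> contains, only the \<open>2 ^ r\<close> values
  of \<open>j\<close> below \<open>2 ^ r\<close> matter. The sum of the squares of all dyadic increments of \<open>D \<circ> q\<close> dominates
  the maximum up to a factor \<open>r\<close> (\<open>increment_le_dyadic_square_maximal\<close>) and has integral
  \<open>O (r * 2 ^ r)\<close>, so the square of the maximum has integral \<open>O (r\<^sup>2 * 2 ^ r)\<close>. Dividing by
  \<open>(H (2 ^ r))\<^sup>2\<close> and summing over \<open>r\<close> gives an almost everywhere finite function.

  If the series diverges, a bad system is built from Menshov's phenomenon: an orthogonal matrix whose
  triangular partial column sums are logarithmically large. The matrix used here has the entries
  \<open>1 / (n sin (\<pi> (k - j + 1/2) / n))\<close>; orthogonality of its rows is a telescoping identity for the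
  cotangent (\<open>cosecant_orthogonal\<close>). The indices from \<open>2 ^ r\<close> to \<open>2 ^ (r + 1) - 1\<close> form one block of
  functions of \<open>r + 2\<close> binary digits of \<open>x\<close>, different blocks using disjoint groups of digits. With
  \<open>a + b = r\<close> and \<open>a \<le> b\<close>, the block consists of \<open>2 ^ a\<close> families of \<open>2 ^ b\<close> functions each. On a part
  of measure about \<open>2 ^ a / 2 ^ b\<close> all functions of a family coincide with half a row of the matrix, up
  to a common sign, which makes the partial sums as large as a multiple of \<open>a * 2 ^ b\<close>. The correlation
  that this creates inside a family is \<open>1 / 2 ^ b\<close> times a constant. It is compensated on the rest of the space by Walsh functions from
  which the single point \<open>y = 0\<close>, at which they all are \<open>1\<close>, has been removed: this deletion lowers
  each inner product inside a family by exactly that amount (\<open>block_gram\<close>). So every block is exactly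
  orthogonal, uniformly bounded and of constant norm.

  It remains to choose \<open>a\<close> and \<open>b\<close> for each \<open>r\<close>. If \<open>\<tau> r\<close> is the term of the divergent series
  and \<open>T r\<close> its partial sum, then \<open>\<sigma> r = \<tau> r / T r\<close> still has a divergent sum (\<open>abel_dini\<close>)
  while \<open>T\<close> tends to infinity. Choosing \<open>2 ^ a / 2 ^ b\<close> comparable to \<open>\<sigma>\<close> makes the partial sums exceed
  \<open>H\<close> by a factor of order \<open>sqrt T\<close> on an event of probability comparable to \<open>\<sigma>\<close>. The events of different
  blocks are independent, so by the second Borel--Cantelli lemma (\<open>digits_hit_infinitely_often\<close>)
  almost every \<open>x\<close> lies in infinitely many of them.
\<close>

section \<open>Maximal inequality along dyadic increments\<close>

text \<open>
  The sum of the squared increments over all dyadic subintervals of \<open>{a..a + 2 ^ s}\<close>.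
\<close>

fun dyadic_square :: "(nat \<Rightarrow> real) \<Rightarrow> nat \<Rightarrow> nat \<Rightarrow> real" where
  "dyadic_square X 0 a = (X (Suc a) - X a)\<^sup>2"
| "dyadic_square X (Suc s) a =
     (X (a + 2 ^ Suc s) - X a)\<^sup>2 + dyadic_square X s a + dyadic_square X s (a + 2 ^ s)"

lemma dyadic_square_nonneg: "0 \<le> dyadic_square X s a"
  by (induction s arbitrary: a) auto

lemma increment_le_dyadic_square: "(X (a + 2 ^ s) - X a)\<^sup>2 \<le> dyadic_square X s a"
proof (cases s)
  case (Suc t)
  then show ?thesis
    using dyadic_square_nonneg[of X t a] dyadic_square_nonneg[of X t "a + 2 ^ t"] by simp
qed simp

text \<open>
  The Cauchy--Schwarz inequality with weights \<open>1\<close> and \<open>t\<close>: one new summand \<open>u\<close> is added to a sum \<open>v\<close> of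
  \<open>t\<close> summands that is already controlled.
\<close>

lemma square_sum_le_weighted:
  fixes u v t :: real
  assumes "0 < t"
  shows "(u + v)\<^sup>2 \<le> (t + 1) * (u\<^sup>2 + v\<^sup>2 / t)"
proof -
  have "0 \<le> (t * u - v)\<^sup>2 / t"
    using assms by simp
  also have "\<dots> = (t + 1) * (u\<^sup>2 + v\<^sup>2 / t) - (u + v)\<^sup>2"
    using assms by (simp add: field_simps power2_eq_square)
  finally show ?thesis by simp
qed

text \<open>
  An initial interval of length \<open>i\<close> is a disjoint union of dyadic intervals, at most one of each of the
  \<open>s + 1\<close> lengths. The induction splits off the longest of them.
\<close>

lemma increment_le_dyadic_square_maximal:
  assumes "i \<le> 2 ^ s"
  shows "(X (a + i) - X a)\<^sup>2 \<le> real (s + 1) * dyadic_square X s a"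
  using assms
proof (induction s arbitrary: a i)
  case 0
  then have "i = 0 \<or> i = 1" by auto
  then show ?case by auto
next
  case (Suc s)
  let ?Q = "dyadic_square X"
  have Q: "?Q s a + ?Q s (a + 2 ^ s) \<le> ?Q (Suc s) a"
    by simp
  show ?case
  proof (cases "i \<le> 2 ^ s")
    case True
    have "(X (a + i) - X a)\<^sup>2 \<le> real (s + 1) * ?Q s a"
      by (rule Suc.IH[OF True])
    also have "\<dots> \<le> real (Suc s + 1) * ?Q (Suc s) a"
      using Q dyadic_square_nonneg[of X s a] dyadic_square_nonneg[of X s "a + 2 ^ s"]
      by (intro mult_mono) auto
    finally show ?thesis .
  next
    case False
    define u where "u = X (a + 2 ^ s) - X a"
    define v where "v = X (a + 2 ^ s + (i - 2 ^ s)) - X (a + 2 ^ s)"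
    have v: "v\<^sup>2 / real (s + 1) \<le> ?Q s (a + 2 ^ s)"
      using Suc.IH[of "i - 2 ^ s" "a + 2 ^ s"] Suc.prems unfolding v_def
      by (simp add: field_simps)
    have "X (a + i) - X a = u + v"
      using False by (simp add: u_def v_def)
    then have "(X (a + i) - X a)\<^sup>2 \<le> (real (s + 1) + 1) * (u\<^sup>2 + v\<^sup>2 / real (s + 1))"
      using square_sum_le_weighted[of "real (s + 1)" u v] by simp
    also have "\<dots> \<le> (real (s + 1) + 1) * (?Q s a + ?Q s (a + 2 ^ s))"
      using v increment_le_dyadic_square[of X a s] unfolding u_def
      by (intro mult_left_mono add_mono) auto
    also have "\<dots> \<le> real (Suc s + 1) * ?Q (Suc s) a"
      using Q by (intro mult_mono) (auto simp: dyadic_square_nonneg)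
    finally show ?thesis .
  qed
qed

lemma dyadic_square_measurable [measurable]:
  assumes [measurable]: "\<And>i. X i \<in> borel_measurable M"
  shows "(\<lambda>x. dyadic_square (\<lambda>i. X i x) s a) \<in> borel_measurable M"
  by (induction s arbitrary: a) auto

text \<open>
  At each of the \<open>s + 1\<close> scales the bounds on the increments add up to the full increment of \<open>psi\<close>.
\<close>

lemma nn_integral_dyadic_square_le:
  fixes X :: "nat \<Rightarrow> 'a \<Rightarrow> real"
  assumes [measurable]: "\<And>i. X i \<in> borel_measurable M"
    and psi: "mono psi" and K: "0 \<le> K"
    and var: "\<And>i j. i \<le> j \<Longrightarrow>
      (\<integral>\<^sup>+x. ennreal ((X j x - X i x)\<^sup>2) \<partial>M) \<le> ennreal (K * (psi j - psi i))"
  shows "(\<integral>\<^sup>+x. ennreal (dyadic_square (\<lambda>i. X i x) s a) \<partial>M)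
    \<le> ennreal (real (s + 1) * (K * (psi (a + 2 ^ s) - psi a)))"
proof (induction s arbitrary: a)
  case 0
  show ?case using var[of a "Suc a"] by simp
next
  case (Suc s)
  have psi_le: "psi i \<le> psi j" if "i \<le> j" for i j
    using psi that by (rule monoD)
  let ?Q = "\<lambda>s a x. dyadic_square (\<lambda>i. X i x) s a"
  let ?d = "\<lambda>i j. K * (psi j - psi i)"
  have d: "0 \<le> ?d i j" if "i \<le> j" for i j
    using psi_le[OF that] K by simp
  have split: "?d a (a + 2 ^ s) + ?d (a + 2 ^ s) (a + 2 ^ s + 2 ^ s) = ?d a (a + 2 ^ Suc s)"
    by (simp add: algebra_simps mult_2)
  have "(\<integral>\<^sup>+x. ennreal (?Q (Suc s) a x) \<partial>M) =
      (\<integral>\<^sup>+x. ennreal ((X (a + 2 ^ Suc s) x - X a x)\<^sup>2) \<partial>M)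
      + (\<integral>\<^sup>+x. ennreal (?Q s a x) \<partial>M) + (\<integral>\<^sup>+x. ennreal (?Q s (a + 2 ^ s) x) \<partial>M)"
    by (simp add: nn_integral_add ennreal_plus dyadic_square_nonneg del: power_Suc)
  also have "\<dots> \<le> ennreal (?d a (a + 2 ^ Suc s))
      + ennreal (real (s + 1) * ?d a (a + 2 ^ s))
      + ennreal (real (s + 1) * ?d (a + 2 ^ s) (a + 2 ^ s + 2 ^ s))"
    by (intro add_mono Suc.IH var) simp
  also have "\<dots> = ennreal (?d a (a + 2 ^ Suc s)
      + real (s + 1) * ?d a (a + 2 ^ s) + real (s + 1) * ?d (a + 2 ^ s) (a + 2 ^ s + 2 ^ s))"
  proof -
    have "0 \<le> ?d a (a + 2 ^ Suc s)" "0 \<le> real (s + 1) * ?d a (a + 2 ^ s)"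
      "0 \<le> real (s + 1) * ?d (a + 2 ^ s) (a + 2 ^ s + 2 ^ s)"
      using d by (auto intro!: mult_nonneg_nonneg psi_le K)
    then show ?thesis by (metis add_nonneg_nonneg ennreal_plus)
  qed
  also have "?d a (a + 2 ^ Suc s)
      + real (s + 1) * ?d a (a + 2 ^ s) + real (s + 1) * ?d (a + 2 ^ s) (a + 2 ^ s + 2 ^ s)
      = real (Suc s + 1) * ?d a (a + 2 ^ Suc s)"
    unfolding split[symmetric] by (simp add: algebra_simps)
  finally show ?case .
qed

section \<open>Convergence of the series suffices\<close>

lemma normalization_pos:
  assumes "normalization H" "1 \<le> t"
  shows "1 \<le> H t"
  using assms by (auto simp: normalization_def)

lemma normalization_mono:
  assumes "normalization H" "1 \<le> s" "s \<le> t"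
  shows "H s \<le> H t"
  using assms by (auto simp: normalization_def mono_on_def)

context admissible_system
begin

lemma Phi_diff: "m \<le> n \<Longrightarrow> Phi g n - Phi g m = (\<Sum>k\<in>{m<..n}. g k)"
  unfolding Phi_def
  by (subst sum_diff[symmetric]) (auto intro!: sum.cong)

lemma Disc_diff: "m \<le> n \<Longrightarrow> Disc F f n x - Disc F f m x = (\<Sum>k\<in>{m<..n}. F k x - f k)"
  unfolding Disc_def
  by (subst sum_diff[symmetric]) (auto intro!: sum.cong)

lemma g_nonneg: "1 \<le> k \<Longrightarrow> 0 \<le> g k"
  using f_nonneg f_le_g by (meson order_trans)

lemma Phi_mono: "m \<le> n \<Longrightarrow> Phi g m \<le> Phi g n"
  unfolding Phi_def by (intro sum_mono2) (auto intro: g_nonneg)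

lemma Phi_nonneg: "0 \<le> Phi g n"
  by (auto simp: Phi_def intro!: sum_nonneg g_nonneg)

lemma Disc_measurable [measurable]: "Disc F f n \<in> borel_measurable M"
  unfolding Disc_def[abs_def]
  by (intro borel_measurable_sum borel_measurable_diff F_measurable) auto

text \<open>
  The value \<open>1\<close> is admitted for all \<open>j\<close> because the variance bound starts at index \<open>1\<close>; it also keeps
  the set nonempty.
\<close>

definition last_below :: "nat \<Rightarrow> nat" where
  "last_below j = Max {N. N = 1 \<or> Phi g N < real j}"

lemma finite_last_below: "finite {N. N = 1 \<or> Phi g N < real j}"
proof -
  obtain N0 where N0: "\<And>N. N \<ge> N0 \<Longrightarrow> real j \<le> Phi g N"
    using Phi_at_top unfolding filterlim_at_top eventually_sequentially by meson
  have "{N. N = 1 \<or> Phi g N < real j} \<subseteq> {..max 1 N0}"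
    using N0 by (auto simp: not_le[symmetric] le_max_iff_disj)
  then show ?thesis using finite_subset by blast
qed

lemma last_below_ge_1: "1 \<le> last_below j"
  unfolding last_below_def by (intro Max_ge finite_last_below) simp

lemma last_below_cases: "last_below j = 1 \<or> Phi g (last_below j) < real j"
  using Max_in[OF finite_last_below, of j] unfolding last_below_def by auto

lemma last_below_upper: "Phi g N < real j \<Longrightarrow> N \<le> last_below j"
  unfolding last_below_def by (intro Max_ge finite_last_below) simp

lemma last_below_mono: "i \<le> j \<Longrightarrow> last_below i \<le> last_below j"
  unfolding last_below_def
  by (intro Max_mono finite_last_below) (auto intro: less_le_trans)

lemma last_below_0: "last_below 0 = 1"
  using last_below_cases[of 0] Phi_nonneg[of "last_below 0"] by simp

lemma Phi_last_below_le: "Phi g (last_below j) - Phi g 1 \<le> real j"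
proof (cases "last_below j = 1")
  case False
  then show ?thesis using last_below_cases[of j] Phi_nonneg[of 1] by linarith
qed simp

text \<open>
  Between \<open>last_below j\<close> and its successor \<open>D\<close> can only decrease through the numbers \<open>f k\<close>. Going up from
  \<open>N\<close> to \<open>last_below (j + 1)\<close> these sum to at most \<open>1\<close>, as \<open>\<Phi>\<close> stays in the unit interval starting at \<open>j\<close>.
  Going up from \<open>last_below j\<close> to \<open>N\<close> the first step may jump over a large part of the scale of \<open>\<Phi>\<close>; its
  contribution is bounded by the maximum of the \<open>f k\<close>, and the remaining steps again by \<open>1\<close>.
\<close>

lemma Disc_between_last_below:
  assumes x: "x \<in> space M" and N: "2 \<le> N"
    and j: "real j \<le> Phi g N" "Phi g N < real (Suc j)"
  shows "\<bar>Disc F f N x\<bar> \<le> max \<bar>Disc F f (last_below j) x\<bar> \<bar>Disc F f (last_below (Suc j)) x\<bar>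
    + Max (f ` {1..N}) + 1"
proof -
  define a b where "a = last_below j" and "b = last_below (Suc j)"
  define m where "m = Max (f ` {1..N})"
  define L where "L = max \<bar>Disc F f a x\<bar> \<bar>Disc F f b x\<bar>"
  have drop: "Disc F f n x \<ge> Disc F f m x - (\<Sum>k\<in>{m<..n}. f k)" if "m \<le> n" for m n
  proof -
    have "- (\<Sum>k\<in>{m<..n}. f k) \<le> (\<Sum>k\<in>{m<..n}. F k x - f k)"
      unfolding sum_negf[symmetric] using x by (intro sum_mono) (simp add: F_nonneg)
    then show ?thesis using Disc_diff[OF that, of x] by linarith
  qed
  have f_le: "(\<Sum>k\<in>{m<..n}. f k) \<le> Phi g n - Phi g m" if "m \<le> n" for m n
    unfolding Phi_diff[OF that] by (intro sum_mono f_le_g) auto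
  have m_nonneg: "0 \<le> m"
  proof -
    have "f 1 \<le> m" unfolding m_def using N by (intro Max_ge) auto
    then show ?thesis using f_nonneg[of 1] by simp
  qed
  have Nb: "N \<le> b" unfolding b_def using j(2) by (rule last_below_upper)
  have aN: "a < N"
  proof (rule ccontr)
    assume "\<not> a < N"
    then have "Phi g N \<le> Phi g a" and "a \<noteq> 1" using N by (auto intro: Phi_mono)
    then show False using last_below_cases[of j] j(1) by (simp add: a_def)
  qed
  have "Disc F f N x \<le> Disc F f b x + 1"
  proof -
    have "Phi g b < real (Suc j)" using last_below_cases[of "Suc j"] Nb N by (auto simp: b_def)
    then show ?thesis using drop[OF Nb] f_le[OF Nb] j(1) by simp
  qed
  moreover have "Disc F f N x \<ge> Disc F f a x - m - 1"
  proof -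
    have "\<not> Phi g (Suc a) < real j" using last_below_upper[of "Suc a" j] by (auto simp: a_def)
    then have "(\<Sum>k\<in>{Suc a<..N}. f k) \<le> 1"
      using f_le[of "Suc a" N ] aN j(2) by simp
    moreover have "{a<..N} = insert (Suc a) {Suc a<..N}" using aN by auto
    then have "(\<Sum>k\<in>{a<..N}. f k) = f (Suc a) + (\<Sum>k\<in>{Suc a<..N}. f k)" by simp
    moreover have "f (Suc a) \<le> m" unfolding m_def using aN by (intro Max_ge) auto
    ultimately show ?thesis using drop[of a N, OF less_imp_le[OF aN]] by linarith
  qed
  moreover have "\<bar>Disc F f a x\<bar> \<le> L" "\<bar>Disc F f b x\<bar> \<le> L"
    by (simp_all add: L_def)
  ultimately have "\<bar>Disc F f N x\<bar> \<le> L + m + 1"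
    using m_nonneg by (simp add: abs_le_iff)
  then show ?thesis by (simp only: L_def m_def a_def b_def)
qed

text \<open>
  The functions \<open>Z r\<close> below majorize the squares of the quotients of \<open>\<bar>D N - D 1\<bar>\<close> by \<open>H (2 ^ r)\<close> at the
  sample points of the dyadic range number \<open>r\<close>. Their integrals are bounded by a constant times the
  terms of the given series, hence their sum is finite almost everywhere and in particular they are bounded in \<open>r\<close>.
\<close>

theorem upper_class_if_series_converges:
  assumes H: "normalization H" and conv: "normalization_series_converges H"
  shows "upper_class_for H M F f g"
proof -
  obtain K where K: "0 < K" and var: "\<And>m n. 1 \<le> m \<Longrightarrow> m < n \<Longrightarrow>
      (\<integral>\<^sup>+ x. ennreal ((Disc F f n x - Disc F f m x)\<^sup>2) \<partial>M) \<le> ennreal (K * (Phi g n - Phi g m))"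
    using variance_bound by blast
  define X where "X j = Disc F f (last_below j)" for j
  have [measurable]: "X j \<in> borel_measurable M" for j
    by (simp add: X_def)
  define Q where "Q r x = dyadic_square (\<lambda>j. X j x) (Suc r) 0" for r x
  define Z where "Z r x = real (r + 2) * Q r x / (H (2 ^ r))\<^sup>2" for r x
  have H_pos: "1 \<le> H (2 ^ r)" for r :: nat
    by (intro normalization_pos[OF H]) simp
  have Q_nonneg: "0 \<le> Q r x" for r x
    unfolding Q_def by (rule dyadic_square_nonneg)
  have [measurable]: "Q r \<in> borel_measurable M" for r
    unfolding Q_def[abs_def] by (rule dyadic_square_measurable) simp
  have Z_nonneg: "0 \<le> Z r x" for r x
    by (simp add: Z_def Q_nonneg)
  have [measurable]: "Z r \<in> borel_measurable M" for r
    unfolding Z_def[abs_def] by measurable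
  have int_Q: "(\<integral>\<^sup>+ x. ennreal (Q r x) \<partial>M) \<le> ennreal (real (r + 2) * (K * 2 ^ Suc r))" for r
  proof -
    have "(\<integral>\<^sup>+ x. ennreal (Q r x) \<partial>M) \<le>
      ennreal (real (Suc r + 1) * (K * (Phi g (last_below (0 + 2 ^ Suc r)) - Phi g (last_below 0))))"
      unfolding Q_def
    proof (rule nn_integral_dyadic_square_le)
      show "mono (\<lambda>j. Phi g (last_below j))"
        by (intro monoI Phi_mono last_below_mono)
      fix i j :: nat assume "i \<le> j"
      then have "last_below i \<le> last_below j" by (rule last_below_mono)
      then show "(\<integral>\<^sup>+ x. ennreal ((X j x - X i x)\<^sup>2) \<partial>M)
          \<le> ennreal (K * (Phi g (last_below j) - Phi g (last_below i)))"
        unfolding X_def using var[of "last_below i" "last_below j"] last_below_ge_1[of i]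
        by (cases "last_below i = last_below j") auto
    qed (use K in auto)
    also have "\<dots> \<le> ennreal (real (r + 2) * (K * 2 ^ Suc r))"
      using Phi_last_below_le[of "2 ^ Suc r"] K
      by (intro ennreal_leI mult_mono[OF _ mult_left_mono] mult_nonneg_nonneg)
        (simp_all add: last_below_0 Phi_mono last_below_ge_1[unfolded One_nat_def])
    finally show ?thesis .
  qed
  define c where "c r = 2 * K * (real (r + 2))\<^sup>2 * 2 ^ r / (H (2 ^ r))\<^sup>2" for r
  have int_Z: "(\<integral>\<^sup>+ x. ennreal (Z r x) \<partial>M) \<le> ennreal (c r)" for r
  proof -
    have "(\<integral>\<^sup>+ x. ennreal (Z r x) \<partial>M)
        = (\<integral>\<^sup>+ x. ennreal (real (r + 2) / (H (2 ^ r))\<^sup>2) * ennreal (Q r x) \<partial>M)"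
      by (intro nn_integral_cong) (simp add: Z_def Q_nonneg ennreal_mult[symmetric])
    also have "\<dots> = ennreal (real (r + 2) / (H (2 ^ r))\<^sup>2) * (\<integral>\<^sup>+ x. ennreal (Q r x) \<partial>M)"
      by (intro nn_integral_cmult) measurable
    also have "\<dots> \<le> ennreal (real (r + 2) / (H (2 ^ r))\<^sup>2) * ennreal (real (r + 2) * (K * 2 ^ Suc r))"
      by (intro mult_left_mono int_Q) simp
    also have "\<dots> = ennreal (c r)"
      using K by (simp add: c_def ennreal_mult[symmetric] power2_eq_square mult_ac)
    finally show ?thesis .
  qed
  have c_nonneg: "0 \<le> c r" for r
    using K by (simp add: c_def)
  have "summable c"
  proof (rule summable_comparison_test_ev)
    show "summable (\<lambda>r. 18 * K * (2 ^ r * (real r)\<^sup>2 / (H (2 ^ r))\<^sup>2))"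
      using conv unfolding normalization_series_converges_def by (rule summable_mult)
    show "\<forall>\<^sub>F r in sequentially. norm (c r) \<le> 18 * K * (2 ^ r * (real r)\<^sup>2 / (H (2 ^ r))\<^sup>2)"
      using eventually_ge_at_top[of 1]
    proof eventually_elim
      case (elim r)
      have "(real (r + 2))\<^sup>2 \<le> (3 * real r)\<^sup>2" using elim by (intro power_mono) auto
      then have "2 * K * (real (r + 2))\<^sup>2 * 2 ^ r \<le> 2 * K * (9 * (real r)\<^sup>2) * 2 ^ r"
        using K by (intro mult_right_mono mult_left_mono) (auto simp: power_mult_distrib)
      then have "c r \<le> (2 * K * (9 * (real r)\<^sup>2) * 2 ^ r) / (H (2 ^ r))\<^sup>2"
        unfolding c_def by (intro divide_right_mono) auto
      then show ?case using c_nonneg[of r] by (simp add: mult_ac)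
    qed
  qed
  have "(\<integral>\<^sup>+ x. (\<Sum>r. ennreal (Z r x)) \<partial>M) = (\<Sum>r. \<integral>\<^sup>+ x. ennreal (Z r x) \<partial>M)"
    by (intro nn_integral_suminf) measurable
  also have "\<dots> \<le> (\<Sum>r. ennreal (c r))"
    by (intro suminf_le int_Z) auto
  also have "\<dots> = ennreal (\<Sum>r. c r)"
    by (rule suminf_ennreal2[OF c_nonneg \<open>summable c\<close>])
  also have "\<dots> < \<infinity>" by simp
  finally have "(\<integral>\<^sup>+ x. (\<Sum>r. ennreal (Z r x)) \<partial>M) \<noteq> \<infinity>" by (rule less_imp_neq)
  then have "AE x in M. (\<Sum>r. ennreal (Z r x)) \<noteq> \<infinity>"
    by (intro nn_integral_PInf_AE) measurable
  then have "AE x in M. (\<lambda>N. Disc F f N x) \<in> O(\<lambda>N. upper_bound_term H f g N)"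
  proof (rule AE_mp, intro AE_I2 impI)
    fix x assume x: "x \<in> space M" and fin: "(\<Sum>r. ennreal (Z r x)) \<noteq> \<infinity>"
    then obtain C2 where C2: "0 \<le> C2" "(\<Sum>r. ennreal (Z r x)) = ennreal C2"
      by (cases "\<Sum>r. ennreal (Z r x)") auto
    have Z_le: "Z r x \<le> C2" for r
    proof -
      have "ennreal (Z r x) \<le> (\<Sum>r. ennreal (Z r x))"
        using sum_le_suminf[of "\<lambda>r. ennreal (Z r x)" "{r}"] by simp
      then show ?thesis using C2 by simp
    qed
    define C where "C = sqrt C2"
    define D where "D = \<bar>Disc F f 1 x\<bar>"
    have C: "0 \<le> C" "C\<^sup>2 = C2" using C2 by (auto simp: C_def)
    \<comment> \<open>the first sample point is the index \<open>1\<close>; the variance bound says nothing about \<open>D 1\<close>, but its value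
        at \<open>x\<close> is a fixed number\<close>
    have X_le: "\<bar>X i x\<bar> \<le> D + C * H (2 ^ r)" if "i \<le> 2 ^ Suc r" for i r
    proof -
      have "(X (0 + i) x - X 0 x)\<^sup>2 \<le> real (Suc r + 1) * Q r x"
        unfolding Q_def by (rule increment_le_dyadic_square_maximal[OF that])
      also have "\<dots> = Z r x * (H (2 ^ r))\<^sup>2"
        using H_pos[of r] by (simp add: Z_def)
      also have "\<dots> \<le> (C * H (2 ^ r))\<^sup>2"
        using Z_le C by (simp add: power_mult_distrib mult_right_mono)
      finally have "\<bar>X i x - X 0 x\<bar> \<le> C * H (2 ^ r)"
        using C H_pos[of r] by (simp add: abs_le_square_iff[symmetric])
      then show ?thesis by (simp add: X_def D_def last_below_0)
    qed
    show "(\<lambda>N. Disc F f N x) \<in> O(\<lambda>N. upper_bound_term H f g N)"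
    proof (rule bigoI[where c = "D + C + 1"])
      have "\<forall>\<^sub>F N in sequentially. 1 \<le> Phi g N"
        using Phi_at_top unfolding filterlim_at_top by blast
      then show "\<forall>\<^sub>F N in sequentially.
          norm (Disc F f N x) \<le> (D + C + 1) * norm (upper_bound_term H f g N)"
        using eventually_ge_at_top[of 2]
      proof eventually_elim
        case (elim N)
        define j where "j = nat \<lfloor>Phi g N\<rfloor>"
        have j: "real j \<le> Phi g N" "Phi g N < real (Suc j)" "1 \<le> j"
          using elim(1) unfolding j_def by linarith+
        define r where "r = floor_log j"
        have r: "2 ^ r \<le> j" "j < 2 ^ Suc r"
          using j(3) floor_log_exp2_le[of j] floor_log_exp2_gt[of j] by (auto simp: r_def)
        let ?h = "H (Phi g N + 1)" and ?m = "Max (f ` {1..N})"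
        have "2 ^ r \<le> real j"
          using r(1) by (metis of_nat_le_iff of_nat_numeral of_nat_power)
        then have "2 ^ r \<le> Phi g N + 1" using j(1) by linarith
        then have h: "H (2 ^ r) \<le> ?h"
          by (intro normalization_mono[OF H]) simp
        then have h1: "1 \<le> ?h" using H_pos[of r] by simp
        have "f 1 \<le> ?m" using elim(2) by (intro Max_ge) auto
        then have m: "0 \<le> ?m" using f_nonneg[of 1] by simp
        have D0: "0 \<le> D" by (simp add: D_def)
        have "\<bar>Disc F f N x\<bar> \<le> max \<bar>X j x\<bar> \<bar>X (Suc j) x\<bar> + ?m + 1"
          using Disc_between_last_below[OF x elim(2) j(1,2)] by (simp add: X_def)
        also have "\<dots> \<le> D + C * H (2 ^ r) + ?m + 1"
          using X_le[of j r] X_le[of "Suc j" r] r(2) by simp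
        also have "\<dots> \<le> D * ?h + C * ?h + ?m + ?h"
        proof -
          have "D * 1 \<le> D * ?h" using D0 h1 by (intro mult_left_mono)
          moreover have "C * H (2 ^ r) \<le> C * ?h" using C(1) h by (intro mult_left_mono)
          ultimately show ?thesis using h1 by linarith
        qed
        also have "\<dots> \<le> (D + C + 1) * (?h + ?m + 1)"
        proof -
          have "0 \<le> (D + C) * (?m + 1)" using D0 C(1) m by (intro mult_nonneg_nonneg) auto
          moreover have "(D + C + 1) * (?h + ?m + 1)
              = D * ?h + C * ?h + ?m + ?h + 1 + (D + C) * (?m + 1)"
            by (simp add: distrib_left distrib_right)
          ultimately show ?thesis by linarith
        qed
        finally show ?case
          using m h1 by (simp add: upper_bound_term_def)
      qed
    qed
  qed
  then show ?thesis unfolding upper_class_for_def .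
qed

end

section \<open>Walsh functions and the cosecant matrix\<close>

lemma sum_div_mod:
  fixes h :: "nat \<Rightarrow> nat \<Rightarrow> real"
  assumes "0 < B"
  shows "(\<Sum>i<A * B. h (i div B) (i mod B)) = (\<Sum>a<A. \<Sum>b<B. h a b)"
proof -
  have "(\<Sum>i<A * B. h (i div B) (i mod B)) = (\<Sum>(a, b)\<in>{..<A} \<times> {..<B}. h a b)"
  proof (rule sum.reindex_bij_witness[where i = "\<lambda>(a, b). a * B + b" and j = "\<lambda>i. (i div B, i mod B)"])
    fix ab assume "ab \<in> {..<A} \<times> {..<B}"
    then obtain a b where ab: "ab = (a, b)" "a < A" "b < B" by auto
    have "a * B + b < Suc a * B" using ab by simp
    also have "\<dots> \<le> A * B" using ab by (intro mult_right_mono) auto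
    finally show "(\<lambda>(a, b). a * B + b) ab \<in> {..<A * B}" using ab by simp
  qed (use assms in \<open>auto simp: less_mult_imp_div_less mult.commute\<close>)
  then show ?thesis by (simp add: sum.cartesian_product)
qed

fun walsh :: "nat \<Rightarrow> nat \<Rightarrow> nat \<Rightarrow> real" where
  "walsh 0 i y = 1"
| "walsh (Suc s) i y = walsh s (i div 2) (y div 2) * (if odd i \<and> odd y then - 1 else 1)"

lemma abs_walsh [simp]: "\<bar>walsh s i y\<bar> = 1"
  by (induction s arbitrary: i y) (auto simp: abs_mult)

lemma walsh_0 [simp]: "walsh s i 0 = 1"
  by (induction s arbitrary: i) auto

lemma walsh_orthogonal:
  assumes "i < 2 ^ s" "j < 2 ^ s"
  shows "(\<Sum>y<2 ^ s. walsh s i y * walsh s j y) = (if i = j then 2 ^ s else 0)"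
  using assms
proof (induction s arbitrary: i j)
  case (Suc s)
  let ?w = "\<lambda>i b. (if odd i \<and> b = (1 :: nat) then - 1 else 1 :: real)"
  let ?h = "\<lambda>y b. walsh s (i div 2) y * walsh s (j div 2) y * (?w i b * ?w j b)"
  have "(\<Sum>y<2 ^ Suc s. walsh (Suc s) i y * walsh (Suc s) j y)
      = (\<Sum>y<2 ^ s * 2. ?h (y div 2) (y mod 2))"
    by (intro sum.cong) (auto simp: odd_iff_mod_2_eq_one)
  also have "\<dots> = (\<Sum>y<2 ^ s. \<Sum>b<2. ?h y b)"
    by (rule sum_div_mod) simp
  also have "\<dots> = (\<Sum>y<2 ^ s. walsh s (i div 2) y * walsh s (j div 2) y) * (\<Sum>b<2. ?w i b * ?w j b)"
    by (simp add: sum_product)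
  also have "(\<Sum>y<2 ^ s. walsh s (i div 2) y * walsh s (j div 2) y)
      = (if i div 2 = j div 2 then 2 ^ s else 0)"
    using Suc.prems by (intro Suc.IH) auto
  also have "(\<Sum>b<2. ?w i b * ?w j b) = (if even i \<longleftrightarrow> even j then 2 else 0)"
    by (auto simp: numeral_2_eq_2)
  finally show ?case
    by (auto split: if_splits) (metis div_mult_mod_eq even_iff_mod_2_eq_zero odd_iff_mod_2_eq_one)+
qed simp

text \<open>
  A cyclic, exactly orthogonal version of the Hilbert matrix \<open>1 / (\<pi> (k - j + 1/2))\<close>.
\<close>

definition cosecant :: "nat \<Rightarrow> nat \<Rightarrow> nat \<Rightarrow> real" where
  "cosecant n k j = 1 / (real n * sin (pi * (real k - real j + 1 / 2) / real n))"

lemma sin_pi_fraction_zeroE: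
  assumes "0 < n" "sin (pi * x / real n) = 0"
  obtains i :: int where "x = real_of_int i * real n"
proof -
  obtain i :: int where "pi * x / real n = real_of_int i * pi"
    using assms by (auto simp: sin_zero_iff_int2)
  then have "pi * x = pi * (real_of_int i * real n)"
    using assms by (simp add: divide_eq_eq mult_ac)
  then have "x = real_of_int i * real n" by simp
  then show ?thesis by (rule that)
qed

lemma sin_half_integer_multiple_neq_0:
  assumes "0 < n"
  shows "sin (pi * (real k - real j + 1 / 2) / real n) \<noteq> 0"
proof
  assume "sin (pi * (real k - real j + 1 / 2) / real n) = 0"
  with assms obtain i :: int where "real k - real j + 1 / 2 = real_of_int i * real n"
    by (rule sin_pi_fraction_zeroE)
  then have "real_of_int (2 * (int k - int j) + 1) = real_of_int (2 * (i * int n))"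
    by (simp add: algebra_simps)
  then have "2 * (int k - int j) + 1 = 2 * (i * int n)"
    by (simp only: of_int_eq_iff)
  then show False by presburger
qed

text \<open>
  Raising \<open>k\<close> by one replaces one term of the sum by another one that lies a full period away.
\<close>

lemma sum_periodic_shift:
  fixes p :: "real \<Rightarrow> real"
  assumes periodic: "\<And>t. p (t + real n) = p t"
  shows "(\<Sum>j<n. p (real k - real j)) = (\<Sum>j<n. p (- real j))"
proof (induction k)
  case (Suc k)
  have "(\<Sum>j<n. p (real (Suc k) - real j)) - (\<Sum>j<n. p (real k - real j))
      = (\<Sum>j<n. p (real (Suc k) - real j) - p (real (Suc k) - real (Suc j)))"
    by (simp add: sum_subtractf)
  also have "\<dots> = p (real (Suc k)) - p (real (Suc k) - real n)"
    by (subst sum_lessThan_telescope') simp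
  also have "\<dots> = 0"
    using periodic[of "real (Suc k) - real n"] by simp
  finally show ?case using Suc by simp
qed simp

lemma cot_diff_eq:
  fixes a b :: real
  assumes "sin a \<noteq> 0" "sin b \<noteq> 0"
  shows "cot a - cot b = sin (b - a) / (sin a * sin b)"
  using assms by (simp add: cot_def sin_diff field_simps)

text \<open>
  The product of two cosecants is a multiple of the difference of the two cotangents, by a factor that
  depends only on \<open>l - k\<close>; and the sum of the cotangents over a full period does not depend on the row.
\<close>

lemma cosecant_orthogonal:
  assumes "k < n" "l < n" "k \<noteq> l"
  shows "(\<Sum>j<n. cosecant n k j * cosecant n l j) = 0"
proof -
  have n: "0 < n" using assms by simp
  define t where "t k j = pi * (real k - real j + 1 / 2) / real n" for k j
  define c where "c = sin (pi * (real l - real k) / real n)"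
  have c: "c \<noteq> 0"
  proof
    assume "c = 0"
    with n obtain i :: int where "real l - real k = real_of_int i * real n"
      unfolding c_def by (rule sin_pi_fraction_zeroE)
    then have "real_of_int (int l) = real_of_int (int k + i * int n)" by simp
    then have "int l = int k + i * int n" by (simp only: of_int_eq_iff)
    then have "int l mod int n = int k mod int n" by simp
    then show False using assms by simp
  qed
  have cot_sum: "(\<Sum>j<n. cot (t k j)) = (\<Sum>j<n. cot (t 0 j))" for k
  proof -
    let ?p = "\<lambda>s. cot (pi * (s + 1 / 2) / real n)"
    have "?p (s + real n) = ?p s" for s
    proof -
      have "pi * (s + real n + 1 / 2) / real n = pi * (s + 1 / 2) / real n + pi"
        using n by (simp add: field_simps)
      then show ?thesis by (simp add: cot_def)
    qed
    from sum_periodic_shift[of ?p n, OF this, of k] show ?thesis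
      by (simp add: t_def)
  qed
  have "cosecant n k j * cosecant n l j = (cot (t k j) - cot (t l j)) / ((real n)\<^sup>2 * c)" for j
  proof -
    have "t l j - t k j = pi * (real l - real k) / real n"
      using n by (simp add: t_def field_simps)
    then show ?thesis
      using cot_diff_eq[of "t k j" "t l j"] sin_half_integer_multiple_neq_0[OF n] c
      by (simp add: cosecant_def t_def[symmetric] c_def[symmetric] power2_eq_square)
  qed
  then have "(\<Sum>j<n. cosecant n k j * cosecant n l j)
      = ((\<Sum>j<n. cot (t k j)) - (\<Sum>j<n. cot (t l j))) / ((real n)\<^sup>2 * c)"
    by (simp add: sum_divide_distrib sum_subtractf diff_divide_distrib)
  then show ?thesis using cot_sum[of k] cot_sum[of l] by simp
qed

lemma sum_lessThan_add:
  fixes h :: "nat \<Rightarrow> real"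
  shows "(\<Sum>j<m + n. h j) = (\<Sum>j<m. h j) + (\<Sum>j<n. h (j + m))"
  by (induction n) (simp_all add: add.commute)

text \<open>
  Pairing \<open>j\<close> with \<open>j + 2 ^ a\<close> shifts the angle by a quarter turn, and
  \<open>1 / sin\<^sup>2 + 1 / cos\<^sup>2 = 4 / sin\<^sup>2\<close> at the double angle. This restricts the evaluation to powers of
  two, which are the only sizes that occur.
\<close>

lemma sum_inverse_sin_square:
  assumes "sin (2 ^ a * t) \<noteq> 0"
  shows "(\<Sum>j<2 ^ a. 1 / (sin (t - pi * real j / 2 ^ a))\<^sup>2) = 4 ^ a / (sin (2 ^ a * t))\<^sup>2"
  using assms
proof (induction a arbitrary: t)
  case (Suc a)
  let ?u = "\<lambda>j. t - pi * real j / 2 ^ Suc a"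
  have double: "1 / (sin (?u j))\<^sup>2 + 1 / (sin (?u (j + 2 ^ a)))\<^sup>2
      = 4 * (1 / (sin (2 * t - pi * real j / 2 ^ a))\<^sup>2)" for j
  proof -
    have "?u (j + 2 ^ a) = ?u j - pi / 2"
      by (simp add: field_simps)
    then have c: "(sin (?u (j + 2 ^ a)))\<^sup>2 = (cos (?u j))\<^sup>2"
      by (simp only: sin_diff[of "?u j" "pi / 2"]) simp
    have two: "2 * t - pi * real j / 2 ^ a = 2 * ?u j"
      by (simp add: field_simps)
    have "sin (2 * ?u j) \<noteq> 0"
    proof
      assume "sin (2 * ?u j) = 0"
      then obtain i :: int where i: "2 * ?u j = real_of_int i * pi"
        by (auto simp: sin_zero_iff_int2)
      have "2 ^ Suc a * t = 2 ^ a * (2 * ?u j) + pi * real j"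
        by (simp add: field_simps)
      also have "\<dots> = real_of_int (2 ^ a * i + int j) * pi"
        unfolding i by (simp add: algebra_simps)
      finally have "sin (2 ^ Suc a * t) = 0"
        using sin_zero_iff_int2 by blast
      with Suc.prems show False by simp
    qed
    then have "sin (?u j) \<noteq> 0" "cos (?u j) \<noteq> 0"
      unfolding sin_double by auto
    then show ?thesis
      unfolding c two sin_double
      by (simp add: power_mult_distrib add_divide_eq_iff divide_simps add.commute
          sin_cos_squared_add del: power_Suc)
  qed
  have "(\<Sum>j<2 ^ Suc a. 1 / (sin (?u j))\<^sup>2)
      = (\<Sum>j<2 ^ a. 1 / (sin (?u j))\<^sup>2) + (\<Sum>j<2 ^ a. 1 / (sin (?u (j + 2 ^ a)))\<^sup>2)"
    unfolding power_Suc[of "2 :: nat"] mult_2 by (rule sum_lessThan_add)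
  also have "\<dots> = 4 * (\<Sum>j<2 ^ a. 1 / (sin (2 * t - pi * real j / 2 ^ a))\<^sup>2)"
    by (simp only: sum.distrib[symmetric] double sum_distrib_left)
  also have "\<dots> = 4 * (4 ^ a / (sin (2 ^ a * (2 * t)))\<^sup>2)"
    using Suc.prems by (subst Suc.IH) (simp_all add: mult.assoc mult.left_commute)
  finally show ?case by (simp add: mult.assoc mult.left_commute)
qed simp

lemma cosecant_normalized: "(\<Sum>j<2 ^ a. (cosecant (2 ^ a) k j)\<^sup>2) = 1"
proof -
  define t where "t = pi * (real k + 1 / 2) / 2 ^ a"
  have sin: "(sin (2 ^ a * t))\<^sup>2 = 1"
  proof -
    have "2 ^ a * t = real k * pi + pi / 2" by (simp add: t_def field_simps)
    then show ?thesis by (simp add: sin_add flip: power_mult)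
  qed
  then have "sin (2 ^ a * t) \<noteq> 0" by auto
  have "(cosecant (2 ^ a) k j)\<^sup>2 = 1 / (sin (t - pi * real j / 2 ^ a))\<^sup>2 / 4 ^ a" for j
  proof -
    have "pi * (real k - real j + 1 / 2) / 2 ^ a = t - pi * real j / 2 ^ a"
      by (simp add: t_def field_simps)
    moreover have "((2 :: real) ^ a)\<^sup>2 = 4 ^ a"
      by (simp add: power_mult[symmetric] mult.commute[of a] power_mult)
    ultimately show ?thesis
      by (simp add: cosecant_def power_divide power_mult_distrib)
  qed
  then have "(\<Sum>j<2 ^ a. (cosecant (2 ^ a) k j)\<^sup>2)
      = (\<Sum>j<2 ^ a. 1 / (sin (t - pi * real j / 2 ^ a))\<^sup>2) / 4 ^ a"
    by (simp add: sum_divide_distrib)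
  also have "\<dots> = 1"
    using sum_inverse_sin_square[OF \<open>sin (2 ^ a * t) \<noteq> 0\<close>] sin by simp
  finally show ?thesis .
qed

lemma cosecant_rows:
  assumes "k < 2 ^ a" "l < 2 ^ a"
  shows "(\<Sum>j<2 ^ a. cosecant (2 ^ a) k j * cosecant (2 ^ a) l j) = (if k = l then 1 else 0)"
  using cosecant_orthogonal[OF assms] cosecant_normalized[of a k]
  by (auto simp: power2_eq_square)

lemma abs_cosecant_le_1:
  assumes "j < 2 ^ a"
  shows "\<bar>cosecant (2 ^ a) k j\<bar> \<le> 1"
proof -
  have "(cosecant (2 ^ a) k j)\<^sup>2 \<le> (\<Sum>j<2 ^ a. (cosecant (2 ^ a) k j)\<^sup>2)"
    using assms by (intro member_le_sum) auto
  then show ?thesis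
    using cosecant_normalized[of a k] by (simp add: abs_square_le_1)
qed

text \<open>
  Above the diagonal all entries of the column are negative and their moduli dominate a multiple of the
  harmonic series, since \<open>sin t \<le> t\<close>.
\<close>

lemma cosecant_triangular_sum:
  assumes "z < n"
  shows "ln (real z + 1) / pi \<le> \<bar>\<Sum>k<z. cosecant n k z\<bar>"
proof -
  have entry: "1 / (pi * real (Suc i)) \<le> - cosecant n (z - Suc i) z" if i: "i < z" for i
  proof -
    define t where "t = pi * (real i + 1 / 2) / real n"
    have t: "0 < t" "t < pi"
      using assms i by (auto simp: t_def pos_divide_less_eq)
    have st: "0 < sin t" "sin t \<le> t"
      using sin_gt_zero[OF t] sin_x_le_x[of t] t by auto
    have "real (z - Suc i) - real z + 1 / 2 = - (real i + 1 / 2)"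
      using i by (simp add: of_nat_diff)
    then have "pi * (real (z - Suc i) - real z + 1 / 2) / real n = - t"
      by (simp only: t_def mult_minus_right minus_divide_left)
    then have c: "- cosecant n (z - Suc i) z = 1 / (real n * sin t)"
      by (simp add: cosecant_def)
    have "real n * sin t \<le> real n * t" using st by (simp add: mult_left_mono)
    also have "\<dots> = pi * (real i + 1 / 2)" using assms by (simp add: t_def)
    also have "\<dots> \<le> pi * real (Suc i)" by simp
    finally have "real n * sin t \<le> pi * real (Suc i)" .
    moreover have "0 < real n * sin t" using st assms by simp
    ultimately show ?thesis unfolding c by (intro divide_left_mono) auto
  qed
  have "ln (real z + 1) / pi \<le> harm z / pi"
    using ln_le_harm[of z] by (simp add: divide_right_mono)
  also have "\<dots> = (\<Sum>i<z. 1 / (pi * real (Suc i)))"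
    by (simp add: harm_altdef sum_divide_distrib inverse_eq_divide mult.commute)
  also have "\<dots> \<le> (\<Sum>i<z. - cosecant n (z - Suc i) z)"
    by (intro sum_mono entry) simp
  also have "\<dots> = - (\<Sum>k<z. cosecant n k z)"
    by (simp add: sum_negf sum.nat_diff_reindex[of "\<lambda>k. cosecant n k z"])
  finally show ?thesis by linarith
qed

section \<open>Bounded orthogonal blocks with large partial sums\<close>

text \<open>
  The function number \<open>i\<close> of the block belongs to the family \<open>i div 2 ^ b\<close>. A point of the finite space
  has the coordinates \<open>e\<close>, \<open>p\<close>, \<open>z\<close>, \<open>y\<close>, ranging over \<open>2\<close>, \<open>2\<close>, \<open>2 ^ a\<close> and \<open>2 ^ b\<close> values. The coordinate
  \<open>e\<close> is a random sign that makes all means vanish; \<open>p\<close> separates the half of the space that carries the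
  punctured Walsh functions from the half that carries the cosecant matrix, there supported on the
  fraction \<open>2 ^ a / 2 ^ b\<close> of the values of \<open>y\<close>.
\<close>

definition block_value :: "nat \<Rightarrow> nat \<Rightarrow> nat \<Rightarrow> nat \<Rightarrow> nat \<Rightarrow> nat \<Rightarrow> nat \<Rightarrow> real" where
  "block_value a b i e p z y = (if e = 0 then 1 / 2 else - 1 / 2) *
     (if p = 0 then (if y = 0 then 0 else walsh a (i div 2 ^ b) z * walsh b (i mod 2 ^ b) y)
      else (if y < 2 ^ a then cosecant (2 ^ a) (i div 2 ^ b) z else 0))"

text \<open>
  All points of the finite space are encoded by numbers \<open>d < 2 ^ (a + b + 2)\<close>.
\<close>

definition block :: "nat \<Rightarrow> nat \<Rightarrow> nat \<Rightarrow> nat \<Rightarrow> real" where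
  "block a b i d = block_value a b i (d div 2 ^ b div 2 ^ a div 2) (d div 2 ^ b div 2 ^ a mod 2)
     (d div 2 ^ b mod 2 ^ a) (d mod 2 ^ b)"

lemma sum_block_coordinates:
  fixes h :: "nat \<Rightarrow> nat \<Rightarrow> nat \<Rightarrow> nat \<Rightarrow> real"
  shows "(\<Sum>d<2 ^ (a + b + 2). h (d div 2 ^ b div 2 ^ a div 2) (d div 2 ^ b div 2 ^ a mod 2)
      (d div 2 ^ b mod 2 ^ a) (d mod 2 ^ b))
    = (\<Sum>e<2. \<Sum>p<2. \<Sum>z<2 ^ a. \<Sum>y<2 ^ b. h e p z y)"
proof -
  have size: "(2 :: nat) ^ (a + b + 2) = 2 * 2 * 2 ^ a * 2 ^ b"
    by (simp add: power_add)
  have "(\<Sum>d<2 ^ (a + b + 2). h (d div 2 ^ b div 2 ^ a div 2) (d div 2 ^ b div 2 ^ a mod 2)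
      (d div 2 ^ b mod 2 ^ a) (d mod 2 ^ b))
    = (\<Sum>d<2 * 2 * 2 ^ a. \<Sum>y<2 ^ b. h (d div 2 ^ a div 2) (d div 2 ^ a mod 2) (d mod 2 ^ a) y)"
    unfolding size
    by (rule sum_div_mod[where h = "\<lambda>d y. h (d div 2 ^ a div 2) (d div 2 ^ a mod 2) (d mod 2 ^ a) y"]) simp
  also have "\<dots> = (\<Sum>s<2 * 2. \<Sum>z<2 ^ a. \<Sum>y<2 ^ b. h (s div 2) (s mod 2) z y)"
    by (rule sum_div_mod[where h = "\<lambda>s z. \<Sum>y<2 ^ b. h (s div 2) (s mod 2) z y"]) simp
  also have "\<dots> = (\<Sum>e<2. \<Sum>p<2. \<Sum>z<2 ^ a. \<Sum>y<2 ^ b. h e p z y)"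
    by (rule sum_div_mod[where h = "\<lambda>e p. \<Sum>z<2 ^ a. \<Sum>y<2 ^ b. h e p z y"]) simp
  finally show ?thesis .
qed

lemma abs_block_le: "\<bar>block a b i d\<bar> \<le> 1 / 2"
proof -
  have "\<bar>block_value a b i e p z y\<bar> \<le> 1 / 2" if "z < 2 ^ a" for e p z y
    using abs_cosecant_le_1[OF that, of "i div 2 ^ b"]
    by (auto simp: block_value_def abs_mult)
  then show ?thesis unfolding block_def by simp
qed

lemma sum_block_eq_0: "(\<Sum>d<2 ^ (a + b + 2). block a b i d) = 0"
proof -
  have "(\<Sum>e<2. \<Sum>p<2. \<Sum>z<2 ^ a. \<Sum>y<2 ^ b. block_value a b i e p z y)
      = (\<Sum>p<2. \<Sum>z<2 ^ a. \<Sum>y<2 ^ b. block_value a b i 0 p z y + block_value a b i 1 p z y)"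
    by (simp add: numeral_2_eq_2 sum.distrib)
  also have "\<dots> = 0"
    by (intro sum.neutral ballI) (simp add: block_value_def)
  finally show ?thesis unfolding block_def sum_block_coordinates .
qed

text \<open>
  Functions of different families are orthogonal on both halves of the space. For one family, up to a common
  factor, the punctured Walsh functions have the inner products \<open>2 ^ a * (2 ^ b - 1)\<close> on the diagonal and
  \<open>- 2 ^ a\<close> off it. The cosecant part adds the squared norm \<open>1\<close> of a row for each of the \<open>2 ^ a\<close> values of
  \<open>y\<close> in its support, which makes up for the defect everywhere.
\<close>

lemma block_gram:
  assumes ab: "a \<le> b" and i: "i < 2 ^ (a + b)" and j: "j < 2 ^ (a + b)"
  shows "(\<Sum>d<2 ^ (a + b + 2). block a b i d * block a b j d)
    = (if i = j then 2 ^ (a + b + 2) / 8 else 0)"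
proof -
  let ?k = "\<lambda>i. i div 2 ^ b :: nat" and ?m = "\<lambda>i. i mod 2 ^ b :: nat"
  let ?W = "\<lambda>z y. walsh a (?k i) z * walsh a (?k j) z * (walsh b (?m i) y * walsh b (?m j) y)"
  let ?C = "\<lambda>z. cosecant (2 ^ a) (?k i) z * cosecant (2 ^ a) (?k j) z"
  let ?same = "(if ?k i = ?k j then 1 else 0) :: real"
  have k: "?k i < 2 ^ a" "?k j < 2 ^ a"
    using i j by (simp_all add: power_add less_mult_imp_div_less)
  have walsh_part: "(\<Sum>z<2 ^ a. \<Sum>y<2 ^ b. if y = 0 then 0 else ?W z y)
      = 2 ^ a * ?same * ((if ?m i = ?m j then 2 ^ b else 0) - 1)"
  proof -
    have "(\<Sum>y<2 ^ b. if y = 0 then 0 else ?W z y)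
        = walsh a (?k i) z * walsh a (?k j) z * ((if ?m i = ?m j then 2 ^ b else 0) - 1)" for z
    proof -
      have "(\<Sum>y<2 ^ b. if y = 0 then 0 else ?W z y)
          = (\<Sum>y<2 ^ b. ?W z y) - (\<Sum>y<(2 :: nat) ^ b. if y = 0 then ?W z 0 else 0)"
        unfolding sum_subtractf[symmetric] by (intro sum.cong) auto
      also have "(\<Sum>y<2 ^ b. ?W z y)
          = walsh a (?k i) z * walsh a (?k j) z * (if ?m i = ?m j then 2 ^ b else 0)"
        using walsh_orthogonal[of "?m i" b "?m j"] by (simp flip: sum_distrib_left)
      finally show ?thesis by (simp add: algebra_simps)
    qed
    then have "(\<Sum>z<2 ^ a. \<Sum>y<2 ^ b. if y = 0 then 0 else ?W z y)
        = (\<Sum>z<2 ^ a. walsh a (?k i) z * walsh a (?k j) z) * ((if ?m i = ?m j then 2 ^ b else 0) - 1)"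
      by (simp only: sum_distrib_right)
    then show ?thesis using walsh_orthogonal[OF k] by simp
  qed
  have cosecant_part: "(\<Sum>z<2 ^ a. \<Sum>y<(2 :: nat) ^ b. if y < 2 ^ a then ?C z else 0) = 2 ^ a * ?same"
  proof -
    have "(\<Sum>y<(2 :: nat) ^ b. if y < 2 ^ a then c else 0) = 2 ^ a * c" for c :: real
    proof -
      have "{..<2 ^ b} \<inter> {y. y < 2 ^ a} = {..<2 ^ a :: nat}"
        using ab by (auto intro: less_le_trans power_increasing)
      then show ?thesis by (simp add: sum.If_cases)
    qed
    then have "(\<Sum>z<2 ^ a. \<Sum>y<(2 :: nat) ^ b. if y < 2 ^ a then ?C z else 0) = 2 ^ a * (\<Sum>z<2 ^ a. ?C z)"
      by (simp only: sum_distrib_left)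
    then show ?thesis using cosecant_rows[OF k] by simp
  qed
  have "(\<Sum>d<2 ^ (a + b + 2). block a b i d * block a b j d)
      = (\<Sum>e<2. \<Sum>p<2. \<Sum>z<2 ^ a. \<Sum>y<2 ^ b. block_value a b i e p z y * block_value a b j e p z y)"
    unfolding block_def by (rule sum_block_coordinates)
  also have "\<dots> = (\<Sum>e<2 :: nat. 1 / 4 * (\<Sum>z<2 ^ a. \<Sum>y<2 ^ b. if y = 0 then 0 else ?W z y)
      + 1 / 4 * (\<Sum>z<2 ^ a. \<Sum>y<(2 :: nat) ^ b. if y < 2 ^ a then ?C z else 0))"
  proof (intro sum.cong refl)
    fix e :: nat
    have "(\<Sum>z<2 ^ a. \<Sum>y<2 ^ b. block_value a b i e 0 z y * block_value a b j e 0 z y)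
        = 1 / 4 * (\<Sum>z<2 ^ a. \<Sum>y<2 ^ b. if y = 0 then 0 else ?W z y)"
      unfolding sum_distrib_left by (intro sum.cong) (auto simp: block_value_def)
    moreover have "(\<Sum>z<2 ^ a. \<Sum>y<2 ^ b. block_value a b i e 1 z y * block_value a b j e 1 z y)
        = 1 / 4 * (\<Sum>z<2 ^ a. \<Sum>y<(2 :: nat) ^ b. if y < 2 ^ a then ?C z else 0)"
      unfolding sum_distrib_left by (intro sum.cong) (auto simp: block_value_def)
    ultimately show "(\<Sum>p<2. \<Sum>z<2 ^ a. \<Sum>y<2 ^ b. block_value a b i e p z y * block_value a b j e p z y)
        = 1 / 4 * (\<Sum>z<2 ^ a. \<Sum>y<2 ^ b. if y = 0 then 0 else ?W z y)
          + 1 / 4 * (\<Sum>z<2 ^ a. \<Sum>y<(2 :: nat) ^ b. if y < 2 ^ a then ?C z else 0)"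
      by (simp add: numeral_2_eq_2)
  qed
  also have "\<dots> = 1 / 2 * (2 ^ a * ?same * (if ?m i = ?m j then 2 ^ b else 0))"
    unfolding walsh_part cosecant_part by (simp add: algebra_simps)
  also have "\<dots> = (if i = j then 2 ^ (a + b + 2) / 8 else 0)"
  proof (cases "i = j")
    case False
    then have "?k i \<noteq> ?k j \<or> ?m i \<noteq> ?m j" by (metis div_mult_mod_eq)
    then show ?thesis using False by auto
  qed (simp add: power_add)
  finally show ?thesis .
qed

text \<open>
  The points at which the cosecant part is active and the column \<open>z\<close> is in the right half, so that the
  partial sums over the rows before \<open>z\<close> are long.
\<close>

definition block_event :: "nat \<Rightarrow> nat \<Rightarrow> nat set" where
  "block_event a b = {d. d < 2 ^ (a + b + 2) \<and> d div 2 ^ b div 2 ^ a mod 2 = 1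
     \<and> 2 ^ (a - 1) \<le> d div 2 ^ b mod 2 ^ a \<and> d mod 2 ^ b < 2 ^ a}"

lemma card_block_event:
  assumes "1 \<le> a" "a \<le> b"
  shows "real (card (block_event a b)) / 2 ^ (a + b + 2) = 2 ^ a / 2 ^ b / 4"
proof -
  let ?h = "\<lambda>(e :: nat) (p :: nat) (z :: nat) (y :: nat). if p = 1 \<and> 2 ^ (a - 1) \<le> z \<and> y < 2 ^ a then 1 :: real else 0"
  have "real (card (block_event a b)) = (\<Sum>d\<in>block_event a b. 1)"
    by simp
  also have "\<dots> = (\<Sum>d<2 ^ (a + b + 2). ?h (d div 2 ^ b div 2 ^ a div 2) (d div 2 ^ b div 2 ^ a mod 2)
      (d div 2 ^ b mod 2 ^ a) (d mod 2 ^ b))"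
    by (rule sum.mono_neutral_cong_left) (auto simp: block_event_def)
  also have "\<dots> = (\<Sum>e<2. \<Sum>p<2. \<Sum>z<2 ^ a. \<Sum>y<2 ^ b. ?h e p z y)"
    by (rule sum_block_coordinates)
  also have "\<dots> = 2 * (\<Sum>z<2 ^ a. \<Sum>y<2 ^ b. ?h 0 1 z y)"
    by (simp add: numeral_2_eq_2)
  also have "(\<Sum>z<2 ^ a. \<Sum>y<2 ^ b. ?h 0 1 z y)
      = (\<Sum>z<(2 :: nat) ^ a. if 2 ^ (a - 1) \<le> z then 2 ^ a else 0)"
  proof (intro sum.cong refl)
    fix z :: nat
    have "{..<2 ^ b} \<inter> {y. y < 2 ^ a} = {..<2 ^ a :: nat}"
      using assms by (auto intro: less_le_trans power_increasing)
    then show "(\<Sum>y<2 ^ b. ?h 0 1 z y) = (if 2 ^ (a - 1) \<le> z then 2 ^ a else 0)"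
      by (simp add: sum.If_cases)
  qed
  also have "\<dots> = 2 ^ a * real (card {2 ^ (a - 1)..<2 ^ a :: nat})"
  proof -
    have "{..<2 ^ a} \<inter> {z. 2 ^ (a - 1) \<le> z} = {2 ^ (a - 1)..<2 ^ a :: nat}" by auto
    then show ?thesis by (simp add: sum.If_cases)
  qed
  also have "real (card {2 ^ (a - 1)..<2 ^ a :: nat}) = 2 ^ a / 2"
    using assms(1) by (cases a) (auto simp: of_nat_diff)
  finally show ?thesis by (simp add: power_add)
qed

text \<open>
  The partial sum is stopped after the families \<open>k < z\<close>, that is, at the diagonal of the matrix, where
  it is \<open>2 ^ b / 2\<close> times a triangular column sum, up to the sign.
  The constant comes from \<open>ln 2 \<ge> 2 / 3\<close> and \<open>\<pi> < 4\<close>.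
\<close>

lemma block_event_large_sum:
  assumes a: "1 \<le> a" and d: "d \<in> block_event a b"
  shows "\<exists>i\<le>2 ^ (a + b). 2 ^ b * (real a - 1) / 12 \<le> \<bar>\<Sum>j<i. block a b j d\<bar>"
proof -
  define z where "z = d div 2 ^ b mod 2 ^ a"
  define e where "e = d div 2 ^ b div 2 ^ a div 2"
  have z: "z < 2 ^ a" "2 ^ (a - 1) \<le> z"
    using d by (auto simp: z_def block_event_def)
  have block_d: "block a b j d = (if e = 0 then 1 / 2 else - 1 / 2) * cosecant (2 ^ a) (j div 2 ^ b) z" for j
    using d by (simp add: block_event_def block_def block_value_def z_def e_def)
  have "(\<Sum>j<z * 2 ^ b. block a b j d)
      = (if e = 0 then 1 / 2 else - 1 / 2) * (\<Sum>j<z * 2 ^ b. cosecant (2 ^ a) (j div 2 ^ b) z)"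
    unfolding block_d by (simp only: sum_distrib_left)
  also have "(\<Sum>j<z * 2 ^ b. cosecant (2 ^ a) (j div 2 ^ b) z) = (\<Sum>k<z. \<Sum>l<(2 :: nat) ^ b. cosecant (2 ^ a) k z)"
    by (rule sum_div_mod[where h = "\<lambda>k l. cosecant (2 ^ a) k z"]) simp
  finally have "\<bar>\<Sum>j<z * 2 ^ b. block a b j d\<bar> = 2 ^ b / 2 * \<bar>\<Sum>k<z. cosecant (2 ^ a) k z\<bar>"
    by (simp add: abs_mult flip: sum_distrib_left)
  moreover have "(real a - 1) / 6 \<le> \<bar>\<Sum>k<z. cosecant (2 ^ a) k z\<bar>"
  proof -
    have "2 ^ (a - 1) \<le> real z"
      using z(2) by (metis of_nat_le_iff of_nat_numeral of_nat_power)
    then have "2 ^ (a - 1) \<le> real z + 1" by linarith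
    then have "ln (2 ^ (a - 1)) \<le> ln (real z + 1)"
      by (intro ln_mono) simp_all
    then have "(real a - 1) * ln 2 \<le> ln (real z + 1)"
      using a by (simp add: ln_realpow of_nat_diff)
    moreover have "(real a - 1) * (2 / 3) \<le> (real a - 1) * ln 2"
      using a ln2_ge_two_thirds by (intro mult_left_mono) auto
    ultimately have "(real a - 1) * (2 / 3) \<le> ln (real z + 1)" by simp
    then have "(real a - 1) * (2 / 3) / 4 \<le> ln (real z + 1) / pi"
      using pi_less_4 pi_gt_zero a by (intro frac_le) auto
    also have "\<dots> \<le> \<bar>\<Sum>k<z. cosecant (2 ^ a) k z\<bar>"
      by (rule cosecant_triangular_sum[OF z(1)])
    finally show ?thesis by simp
  qed
  ultimately have "2 ^ b / 2 * ((real a - 1) / 6) \<le> \<bar>\<Sum>j<z * 2 ^ b. block a b j d\<bar>"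
    by (simp only: mult_left_mono) simp
  moreover have "z * 2 ^ b \<le> 2 ^ (a + b)"
    using z(1) by (simp add: power_add)
  ultimately show ?thesis by (intro exI[of _ "z * 2 ^ b"]) (simp add: algebra_simps)
qed

section \<open>Independent binary digit groups of a point of the unit interval\<close>

definition leading_bits :: "nat \<Rightarrow> real \<Rightarrow> nat" where
  "leading_bits s x = nat \<lfloor>2 ^ s * x\<rfloor>"

text \<open>
  The digit group number \<open>r\<close> has \<open>r + 2\<close> bits, enough to encode a point of the space of a block with
  \<open>2 ^ r\<close> functions; \<open>offset r\<close> counts the bits of all previous groups.
\<close>

definition offset :: "nat \<Rightarrow> nat" where
  "offset r = (\<Sum>q<r. q + 2)"

definition digit :: "nat \<Rightarrow> real \<Rightarrow> nat" where
  "digit r x = leading_bits (offset (Suc r)) x mod 2 ^ (r + 2)"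

lemma leading_bits_div: "leading_bits s x = leading_bits (s + t) x div 2 ^ t"
proof -
  have "\<lfloor>2 ^ s * x\<rfloor> = \<lfloor>2 ^ (s + t) * x / real_of_int (2 ^ t)\<rfloor>"
    by (simp add: power_add)
  also have "\<dots> = \<lfloor>2 ^ (s + t) * x\<rfloor> div 2 ^ t"
    by (rule floor_divide_real_eq_div) simp
  finally show ?thesis
    unfolding leading_bits_def by (simp add: nat_div_distrib' nat_power_eq)
qed

lemma offset_Suc: "offset (Suc r) = offset r + (r + 2)"
  by (simp add: offset_def)

lemma offset_mono: "q \<le> r \<Longrightarrow> offset q \<le> offset r"
  unfolding offset_def by (intro sum_mono2) auto

lemma leading_bits_offset_Suc:
  "leading_bits (offset r) x = leading_bits (offset (Suc r)) x div 2 ^ (r + 2)"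
  unfolding offset_Suc by (rule leading_bits_div)

lemma digit_from_leading_bits:
  assumes "q < r"
  shows "digit q x = leading_bits (offset r) x div 2 ^ (offset r - offset (Suc q)) mod 2 ^ (q + 2)"
  using leading_bits_div[of "offset (Suc q)" x "offset r - offset (Suc q)"] offset_mono[of "Suc q" r] assms
  by (simp add: digit_def)

text \<open>
  The function is constant on the dyadic intervals of length \<open>1 / 2 ^ s\<close>. The endpoint \<open>1\<close>, whose
  leading bits overflow, is a null set.
\<close>

lemma has_integral_leading_bits:
  fixes h :: "nat \<Rightarrow> real"
  shows "has_bochner_integral unit_interval (\<lambda>x. h (leading_bits s x)) ((\<Sum>i<2 ^ s. h i) / 2 ^ s)"
proof -
  let ?I = "\<lambda>i. {real i / 2 ^ s..<real (Suc i) / 2 ^ s}"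
  have meas: "(\<lambda>x. h (leading_bits s x)) \<in> borel_measurable borel"
    unfolding leading_bits_def by measurable
  have "has_bochner_integral lborel (\<lambda>x. \<Sum>i<2 ^ s. h i * indicator (?I i) x)
      (\<Sum>i<2 ^ s. h i * measure lborel (?I i))"
    by (intro has_bochner_integral_sum has_bochner_integral_mult_right
        has_bochner_integral_real_indicator) (simp_all add: divide_right_mono)
  also have "(\<Sum>i<2 ^ s. h i * measure lborel (?I i)) = (\<Sum>i<2 ^ s. h i) / 2 ^ s"
    unfolding sum_divide_distrib
    by (intro sum.cong refl) (simp add: divide_right_mono flip: diff_divide_distrib)
  finally have steps: "has_bochner_integral lborel (\<lambda>x. \<Sum>i<2 ^ s. h i * indicator (?I i) x)
      ((\<Sum>i<2 ^ s. h i) / 2 ^ s)" .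
  have ae: "AE x in lborel. (\<Sum>i<2 ^ s. h i * indicator (?I i) x)
      = indicator {0..1} x *\<^sub>R h (leading_bits s x)"
    using AE_lborel_singleton[of 1]
  proof eventually_elim
    case (elim x)
    have ind: "indicator (?I i) x = (if 0 \<le> x \<and> leading_bits s x = i then 1 else 0 :: real)" for i
    proof -
      have "x \<in> ?I i \<longleftrightarrow> real i \<le> 2 ^ s * x \<and> 2 ^ s * x < real i + 1"
        by (auto simp: field_simps)
      also have "\<dots> \<longleftrightarrow> \<lfloor>2 ^ s * x\<rfloor> = int i"
        by (auto simp: floor_eq_iff)
      also have "\<dots> \<longleftrightarrow> 0 \<le> x \<and> leading_bits s x = i"
      proof -
        have "0 \<le> \<lfloor>2 ^ s * x\<rfloor> \<longleftrightarrow> 0 \<le> x"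
          using mult_le_cancel_left_pos[of "2 ^ s" 0 x] by simp
        then show ?thesis unfolding leading_bits_def by (metis nat_int int_nat_eq of_nat_0_le_iff)
      qed
      finally show ?thesis by (simp add: indicator_def)
    qed
    have "(\<Sum>i<2 ^ s. h i * indicator (?I i) x)
        = (\<Sum>i<2 ^ s. if i = leading_bits s x then (if 0 \<le> x then h i else 0) else 0)"
      unfolding ind by (intro sum.cong) auto
    also have "\<dots> = (if 0 \<le> x \<and> leading_bits s x < 2 ^ s then h (leading_bits s x) else 0)"
      by simp
    finally have sum_eq: "(\<Sum>i<2 ^ s. h i * indicator (?I i) x)
        = (if 0 \<le> x \<and> leading_bits s x < 2 ^ s then h (leading_bits s x) else 0)" .
    have "leading_bits s x < 2 ^ s \<longleftrightarrow> x < 1" if "0 \<le> x"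
    proof -
      have "leading_bits s x < 2 ^ s \<longleftrightarrow> \<lfloor>2 ^ s * x\<rfloor> < 2 ^ s"
        using that unfolding leading_bits_def by (subst nat_less_iff) auto
      also have "\<dots> \<longleftrightarrow> 2 ^ s * x < 2 ^ s * 1"
        by (simp add: floor_less_iff)
      also have "\<dots> \<longleftrightarrow> x < 1"
        by (rule mult_less_cancel_left_pos) simp
      finally show ?thesis .
    qed
    then show ?case
      unfolding sum_eq using elim by auto
  qed
  have "(\<lambda>x. indicator {0..1} x *\<^sub>R h (leading_bits s x)) \<in> borel_measurable lborel"
    using meas by measurable
  moreover have "(\<lambda>x. \<Sum>i<2 ^ s. h i * indicator (?I i) x) \<in> borel_measurable lborel"
    by measurable
  ultimately have "has_bochner_integral lborel (\<lambda>x. indicator {0..1} x *\<^sub>R h (leading_bits s x))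
      ((\<Sum>i<2 ^ s. h i) / 2 ^ s)"
    using steps ae has_bochner_integral_cong_AE by blast
  then show ?thesis
    by (simp add: has_bochner_integral_iff integrable_restrict_space integral_restrict_space)
qed

text \<open>
  Independence of a digit group from all earlier bits: quotient and remainder of a number below
  \<open>2 ^ offset r * 2 ^ (r + 2)\<close> vary independently.
\<close>

lemma has_integral_leading_bits_digit:
  fixes A B :: "nat \<Rightarrow> real"
  shows "has_bochner_integral unit_interval (\<lambda>x. A (leading_bits (offset r) x) * B (digit r x))
    ((\<integral>x. A (leading_bits (offset r) x) \<partial>unit_interval) * ((\<Sum>d<2 ^ (r + 2). B d) / 2 ^ (r + 2)))"
proof -
  let ?s = "offset (Suc r)"
  have "has_bochner_integral unit_interval
      (\<lambda>x. A (leading_bits ?s x div 2 ^ (r + 2)) * B (leading_bits ?s x mod 2 ^ (r + 2)))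
      ((\<Sum>i<2 ^ ?s. A (i div 2 ^ (r + 2)) * B (i mod 2 ^ (r + 2))) / 2 ^ ?s)"
    by (rule has_integral_leading_bits)
  moreover have "(\<Sum>i<2 ^ ?s. A (i div 2 ^ (r + 2)) * B (i mod 2 ^ (r + 2)))
      = (\<Sum>i<2 ^ offset r. A i) * (\<Sum>d<2 ^ (r + 2). B d)"
    unfolding offset_Suc power_add[of 2 "offset r"] sum_product
    by (rule sum_div_mod[where h = "\<lambda>i d. A i * B d"]) simp
  moreover have "(\<integral>x. A (leading_bits (offset r) x) \<partial>unit_interval) = (\<Sum>i<2 ^ offset r. A i) / 2 ^ offset r"
    by (rule has_bochner_integral_integral_eq[OF has_integral_leading_bits])
  ultimately show ?thesis
    by (simp add: offset_Suc power_add[of 2 "offset r"] digit_def leading_bits_offset_Suc[of r] mult.left_commute)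
qed

lemma has_integral_digit:
  fixes B :: "nat \<Rightarrow> real"
  shows "has_bochner_integral unit_interval (\<lambda>x. B (digit r x)) ((\<Sum>d<2 ^ (r + 2). B d) / 2 ^ (r + 2))"
  using has_integral_leading_bits_digit[of "\<lambda>_. 1" r B]
    has_bochner_integral_integral_eq[OF has_integral_leading_bits[of "\<lambda>_. 1" 0]]
  by simp

lemma prod_digits_from_leading_bits:
  fixes b :: "nat \<Rightarrow> nat \<Rightarrow> real"
  obtains A where "\<And>x. (\<Prod>r\<in>{p..<q}. b r (digit r x)) = A (leading_bits (offset q) x)"
  by (rule that[of "\<lambda>c. \<Prod>r\<in>{p..<q}. b r (c div 2 ^ (offset q - offset (Suc r)) mod 2 ^ (r + 2))"])
    (rule prod.cong, rule refl, rule arg_cong, rule digit_from_leading_bits, simp)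

lemma integral_prod_digits:
  fixes b :: "nat \<Rightarrow> nat \<Rightarrow> real"
  shows "has_bochner_integral unit_interval (\<lambda>x. \<Prod>r\<in>{p..<q}. b r (digit r x))
    (\<Prod>r\<in>{p..<q}. (\<Sum>d<2 ^ (r + 2). b r d) / 2 ^ (r + 2))"
proof (induction q)
  case 0
  then show ?case using has_integral_leading_bits[of "\<lambda>_. 1" 0] by simp
next
  case (Suc q)
  show ?case
  proof (cases "p \<le> q")
    case True
    obtain A where A: "\<And>x. (\<Prod>r\<in>{p..<q}. b r (digit r x)) = A (leading_bits (offset q) x)"
      using prod_digits_from_leading_bits[where b = b] by blast
    show ?thesis
      using has_integral_leading_bits_digit[of A q "b q"] True
        has_bochner_integral_integral_eq[OF Suc.IH]
      by (simp add: A)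
  next
    case False
    then show ?thesis using has_integral_leading_bits[of "\<lambda>_. 1" 0] by simp
  qed
qed

text \<open>
  From \<open>1 - t \<le> exp (- t)\<close>, a positive lower bound for the products would bound the partial sums of \<open>P\<close>.
\<close>

lemma not_summable_prod_tendsto_0:
  fixes P :: "nat \<Rightarrow> real"
  assumes P: "\<And>r. 0 \<le> P r" "\<And>r. P r \<le> 1" and div: "\<not> summable P" and "0 < \<epsilon>"
  shows "\<exists>q. (\<Prod>r\<in>{p..<q}. 1 - P r) < \<epsilon>"
proof (rule ccontr)
  assume "\<nexists>q. (\<Prod>r\<in>{p..<q}. 1 - P r) < \<epsilon>"
  then have ge: "\<epsilon> \<le> (\<Prod>r\<in>{p..<q}. 1 - P r)" for q by (simp add: not_less)
  have "(\<Sum>r<n. P (r + p)) \<le> - ln \<epsilon>" for n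
  proof -
    have "\<epsilon> \<le> (\<Prod>r\<in>{p..<p + n}. 1 - P r)" by (rule ge)
    also have "\<dots> \<le> (\<Prod>r\<in>{p..<p + n}. exp (- P r))"
      using P exp_ge_add_one_self[of "- P _"] by (intro prod_mono) auto
    also have "\<dots> = exp (- (\<Sum>r\<in>{p..<p + n}. P r))"
      by (simp add: exp_sum sum_negf flip: sum_negf)
    also have "(\<Sum>r\<in>{p..<p + n}. P r) = (\<Sum>r<n. P (r + p))"
      using sum.shift_bounds_nat_ivl[of P 0 p n] by (simp add: atLeast0LessThan add.commute)
    finally have "ln \<epsilon> \<le> ln (exp (- (\<Sum>r<n. P (r + p))))"
      using \<open>0 < \<epsilon>\<close> by (subst ln_le_cancel_iff) auto
    then show ?thesis by simp
  qed
  then have "summable (\<lambda>r. P (r + p))"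
    using P by (intro summableI_nonneg_bounded) auto
  then show False using div by (simp add: summable_iff_shift)
qed

text \<open>
  The second Borel--Cantelli lemma. The probability that no group from \<open>p\<close> on hits its target is at most
  the product of the complementary probabilities, which is \<open>0\<close> by \<open>not_summable_prod_tendsto_0\<close>.
\<close>

theorem digits_hit_infinitely_often:
  assumes G: "\<And>r. G r \<subseteq> {..<2 ^ (r + 2)}"
    and div: "\<not> summable (\<lambda>r. real (card (G r)) / 2 ^ (r + 2))"
  shows "AE x in unit_interval. \<exists>\<^sub>\<infinity>r. digit r x \<in> G r"
proof -
  let ?P = "\<lambda>r. real (card (G r)) / 2 ^ (r + 2)"
  have P: "0 \<le> ?P r" "?P r \<le> 1" for r
  proof -
    have "card (G r) \<le> card {..<2 ^ (r + 2) :: nat}" using G by (intro card_mono) auto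
    then have "real (card (G r)) \<le> real (2 ^ (r + 2))" by (simp only: of_nat_le_iff card_lessThan)
    then show "?P r \<le> 1" by simp
  qed simp
  have digit_meas [measurable]: "digit r \<in> measurable unit_interval (count_space UNIV)" for r
  proof -
    have "digit r \<in> measurable borel (count_space UNIV)"
      unfolding digit_def[abs_def] leading_bits_def by measurable
    then show ?thesis by (intro measurable_restrict_space1) simp
  qed
  have "AE x in unit_interval. \<exists>r\<ge>p. digit r x \<in> G r" for p
  proof -
    define B where "B = {x \<in> space unit_interval. \<forall>r\<ge>p. digit r x \<notin> G r}"
    have [measurable]: "B \<in> sets unit_interval" unfolding B_def by measurable
    let ?b = "\<lambda>r d. 1 - indicator (G r) d :: real"
    have bound: "emeasure unit_interval B \<le> ennreal (\<Prod>r\<in>{p..<q}. 1 - ?P r)" for q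
    proof -
      have avg: "(\<Sum>d<2 ^ (r + 2). ?b r d) / 2 ^ (r + 2) = 1 - ?P r" for r
      proof -
        have "(\<Sum>d<2 ^ (r + 2). indicator (G r) d :: real) = real (card (G r))"
          using G[of r] by (simp add: indicator_def sum.If_cases Int_absorb1)
        then show ?thesis by (simp add: sum_subtractf diff_divide_distrib)
      qed
      have hbi: "has_bochner_integral unit_interval (\<lambda>x. \<Prod>r\<in>{p..<q}. ?b r (digit r x))
          (\<Prod>r\<in>{p..<q}. 1 - ?P r)"
        using integral_prod_digits[where b = ?b] by (simp only: avg)
      have "emeasure unit_interval B = (\<integral>\<^sup>+x. indicator B x \<partial>unit_interval)"
        by simp
      also have "\<dots> \<le> (\<integral>\<^sup>+x. ennreal (\<Prod>r\<in>{p..<q}. ?b r (digit r x)) \<partial>unit_interval)"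
        by (intro nn_integral_mono) (auto simp: indicator_def B_def)
      also have "\<dots> = ennreal (\<Prod>r\<in>{p..<q}. 1 - ?P r)"
        using hbi by (subst nn_integral_eq_integral)
          (auto simp: has_bochner_integral_iff intro!: prod_nonneg AE_I2 simp: indicator_def)
      finally show ?thesis .
    qed
    have small: "emeasure unit_interval B \<le> ennreal \<epsilon>" if pos: "0 < \<epsilon>" for \<epsilon> :: real
    proof -
      obtain q where "(\<Prod>r\<in>{p..<q}. 1 - ?P r) < \<epsilon>"
        using not_summable_prod_tendsto_0[of ?P, OF P div pos] by blast
      then show ?thesis using bound[of q] by (meson ennreal_leI less_imp_le order_trans)
    qed
    have "emeasure unit_interval B \<le> 0"
      by (rule ennreal_le_epsilon) (simp only: add_0_left small)
    then have "AE x in unit_interval. x \<notin> B"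
      by (intro AE_not_in) (auto simp: null_sets_def)
    then show ?thesis
      by (rule AE_mp) (auto simp: B_def)
  qed
  then have "AE x in unit_interval. \<forall>p. \<exists>r\<ge>p. digit r x \<in> G r"
    by (simp add: AE_all_countable)
  then show ?thesis by (simp add: INFM_nat_le)
qed

section \<open>An orthogonal sequence on the unit interval\<close>

text \<open>
  The interface between the finite constructions and the unit interval: \<open>\<psi> r i\<close> is the function number \<open>i\<close>
  of the block \<open>r\<close>, on a space of \<open>2 ^ (r + 2)\<close> equally likely points.
\<close>

locale block_system =
  fixes \<psi> :: "nat \<Rightarrow> nat \<Rightarrow> nat \<Rightarrow> real"
  assumes bounded: "\<And>r i d. \<bar>\<psi> r i d\<bar> \<le> 1 / 2"
    and centred: "\<And>r i. (\<Sum>d<2 ^ (r + 2). \<psi> r i d) = 0"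
    and gram: "\<And>r i j. i < 2 ^ r \<Longrightarrow> j < 2 ^ r \<Longrightarrow>
      (\<Sum>d<2 ^ (r + 2). \<psi> r i d * \<psi> r j d) = (if i = j then 2 ^ (r + 2) / 8 else 0)"
begin

text \<open>
  The index \<open>k\<close> lies in the block \<open>floor_log k\<close>, which occupies the indices from \<open>2 ^ floor_log k\<close> up to the next
  power of two, so that every index \<open>k \<ge> 1\<close> is covered.
\<close>

definition deviation :: "nat \<Rightarrow> real \<Rightarrow> real" where
  "deviation k x = \<psi> (floor_log k) (k - 2 ^ floor_log k) (digit (floor_log k) x)"

lemma position_in_block_less: "1 \<le> k \<Longrightarrow> k - 2 ^ floor_log k < 2 ^ floor_log k"
  using floor_log_exp2_gt[of k] floor_log_exp2_le[of k] by linarith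

lemma deviation_in_block:
  assumes "j < 2 ^ r"
  shows "deviation (2 ^ r + j) x = \<psi> r j (digit r x)"
proof -
  have "floor_log (2 ^ r + j) = r"
    using assms by (intro floor_log_eqI) auto
  then show ?thesis by (simp add: deviation_def)
qed

lemma abs_deviation_le: "\<bar>deviation k x\<bar> \<le> 1 / 2"
  unfolding deviation_def by (rule bounded)

lemma has_integral_deviation: "has_bochner_integral unit_interval (deviation k) 0"
  using has_integral_digit[of "\<psi> (floor_log k) (k - 2 ^ floor_log k)" "floor_log k"]
  unfolding centred deviation_def[abs_def] by simp

text \<open>
  The earlier block is a function of the leading bits, of which the digit group of the later block is
  independent, and the later block has mean \<open>0\<close>.
\<close>

lemma has_integral_deviation_mult_less:
  assumes "floor_log k < floor_log l"
  shows "has_bochner_integral unit_interval (\<lambda>x. deviation k x * deviation l x) 0"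
  unfolding deviation_def digit_from_leading_bits[OF assms]
  using has_integral_leading_bits_digit[of
      "\<lambda>c. \<psi> (floor_log k) (k - 2 ^ floor_log k)
        (c div 2 ^ (offset (floor_log l) - offset (Suc (floor_log k))) mod 2 ^ (floor_log k + 2))"
      "floor_log l" "\<psi> (floor_log l) (l - 2 ^ floor_log l)"]
  unfolding centred by simp

lemma has_integral_deviation_mult:
  assumes "1 \<le> k" "1 \<le> l"
  shows "has_bochner_integral unit_interval (\<lambda>x. deviation k x * deviation l x)
    (if k = l then 1 / 8 else 0)"
proof (cases "floor_log k" "floor_log l" rule: linorder_cases)
  case less
  then have "k \<noteq> l" by auto
  then show ?thesis using has_integral_deviation_mult_less[OF less] by simp
next
  case greater
  then have "k \<noteq> l" by auto
  then show ?thesis using has_integral_deviation_mult_less[OF greater] by (simp add: mult.commute)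
next
  case equal
  define r where "r = floor_log k"
  define i j where "i = k - 2 ^ r" and "j = l - 2 ^ r"
  have i: "i < 2 ^ r" and j: "j < 2 ^ r"
    using position_in_block_less[OF assms(1)] position_in_block_less[OF assms(2)] equal
    by (simp_all add: i_def j_def r_def)
  have kl: "k = 2 ^ r + i" "l = 2 ^ r + j"
    using floor_log_exp2_le[of k] floor_log_exp2_le[of l] assms equal
    by (simp_all add: i_def j_def r_def)
  have "has_bochner_integral unit_interval (\<lambda>x. \<psi> r i (digit r x) * \<psi> r j (digit r x))
      ((\<Sum>d<2 ^ (r + 2). \<psi> r i d * \<psi> r j d) / 2 ^ (r + 2))"
    by (rule has_integral_digit)
  moreover have "(\<Sum>d<2 ^ (r + 2). \<psi> r i d * \<psi> r j d) / 2 ^ (r + 2) = (if k = l then 1 / 8 else 0)"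
    unfolding gram[OF i j] kl by simp
  ultimately show ?thesis
    unfolding kl deviation_in_block[OF i] deviation_in_block[OF j] by simp
qed

lemma has_integral_deviation_sum_square:
  assumes "m \<le> n"
  shows "has_bochner_integral unit_interval (\<lambda>x. (\<Sum>k\<in>{m<..n}. deviation k x)\<^sup>2)
    (1 / 8 * (real n - real m))"
proof -
  have "has_bochner_integral unit_interval
      (\<lambda>x. \<Sum>k\<in>{m<..n}. \<Sum>l\<in>{m<..n}. deviation k x * deviation l x)
      (\<Sum>k\<in>{m<..n}. \<Sum>l\<in>{m<..n}. if k = l then 1 / 8 else 0)"
    by (intro has_bochner_integral_sum has_integral_deviation_mult) auto
  moreover have "(\<Sum>k\<in>{m<..n}. \<Sum>l\<in>{m<..n}. if k = l then 1 / 8 else 0 :: real)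
      = 1 / 8 * (real n - real m)"
    using assms by (simp add: of_nat_diff)
  ultimately show ?thesis by (simp add: power2_eq_square sum_product)
qed

lemma Disc_deviation: "Disc (\<lambda>k x. 1 / 2 + deviation k x) (\<lambda>_. 1 / 2) N x = (\<Sum>k=1..N. deviation k x)"
  by (simp add: Disc_def)

lemma emeasure_unit_interval: "emeasure unit_interval (space unit_interval) = 1"
  by (simp add: emeasure_restrict_space)

lemma admissible_system_deviation:
  "admissible_system unit_interval (\<lambda>k x. 1 / 2 + deviation k x) (\<lambda>_. 1 / 2) (\<lambda>_. 1)"
proof -
  interpret finite_measure unit_interval
    by (rule finite_measureI) (subst emeasure_unit_interval, simp)
  show ?thesis
  proof
    show "0 < emeasure unit_interval (space unit_interval)"
      unfolding emeasure_unit_interval by simp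
    show "(\<lambda>x. 1 / 2 + deviation k x) \<in> borel_measurable unit_interval" for k
      using has_integral_deviation[of k] by (intro borel_measurable_add) (auto simp: has_bochner_integral_iff)
    show "0 \<le> 1 / 2 + deviation k x" for k x
      using abs_deviation_le[of k x] by linarith
    show "filterlim (Phi (\<lambda>_. 1)) at_top sequentially"
      unfolding Phi_def[abs_def] using filterlim_real_sequentially by simp
    show "\<exists>K>0. \<forall>m n. 1 \<le> m \<and> m < n \<longrightarrow>
      (\<integral>\<^sup>+ x. ennreal ((Disc (\<lambda>k x. 1 / 2 + deviation k x) (\<lambda>_. 1 / 2) n x
          - Disc (\<lambda>k x. 1 / 2 + deviation k x) (\<lambda>_. 1 / 2) m x)\<^sup>2) \<partial>unit_interval)
        \<le> ennreal (K * (Phi (\<lambda>_. 1) n - Phi (\<lambda>_. 1) m))"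
    proof (intro exI[of _ "1 / 8"] conjI allI impI)
      fix m n :: nat assume mn: "1 \<le> m \<and> m < n"
      have diff: "(\<Sum>k=1..n. deviation k x) - (\<Sum>k=1..m. deviation k x)
          = (\<Sum>k\<in>{m<..n}. deviation k x)" for x
      proof -
        have "{1..n} - {1..m} = {m<..n}" using mn by auto
        then show ?thesis using mn by (simp flip: sum_diff add: atLeastAtMost_iff)
      qed
      have "(\<integral>\<^sup>+ x. ennreal ((\<Sum>k\<in>{m<..n}. deviation k x)\<^sup>2) \<partial>unit_interval)
          = ennreal (1 / 8 * (real n - real m))"
        using has_integral_deviation_sum_square[of m n] mn
        by (subst nn_integral_eq_integral) (auto simp: has_bochner_integral_iff)
      then show "(\<integral>\<^sup>+ x. ennreal ((Disc (\<lambda>k x. 1 / 2 + deviation k x) (\<lambda>_. 1 / 2) n x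
          - Disc (\<lambda>k x. 1 / 2 + deviation k x) (\<lambda>_. 1 / 2) m x)\<^sup>2) \<partial>unit_interval)
        \<le> ennreal (1 / 8 * (Phi (\<lambda>_. 1) n - Phi (\<lambda>_. 1) m))"
        unfolding Disc_deviation diff by (simp add: Phi_def)
    qed simp
  qed auto
qed

text \<open>
  A sum over a segment of a block is the difference of two partial sums, so one of them is at least half as
  large in modulus.
\<close>

lemma block_sum_le_partial_sum:
  assumes "i \<le> 2 ^ r"
  shows "\<exists>N. 2 ^ r - 1 \<le> N \<and> N < 2 ^ Suc r
    \<and> \<bar>\<Sum>j<i. \<psi> r j (digit r x)\<bar> \<le> 2 * \<bar>\<Sum>k=1..N. deviation k x\<bar>"
proof -
  define S where "S N = (\<Sum>k=1..N. deviation k x)" for N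
  have S_Suc: "S (Suc n) = S n + deviation (Suc n) x" for n
    by (simp add: S_def)
  have step: "S (2 ^ r - 1 + i) = S (2 ^ r - 1) + (\<Sum>j<i. \<psi> r j (digit r x))" if "i \<le> 2 ^ r" for i
    using that
  proof (induction i)
    case (Suc i)
    have "S (2 ^ r - 1 + Suc i) = S (2 ^ r - 1 + i) + deviation (Suc (2 ^ r - 1 + i)) x"
      by (simp only: S_Suc add_Suc_right)
    also have "Suc (2 ^ r - 1 + i) = 2 ^ r + i"
      by simp
    also have "deviation (2 ^ r + i) x = \<psi> r i (digit r x)"
      using Suc.prems by (intro deviation_in_block) simp
    finally show ?case using Suc by simp
  qed simp
  define B where "B = (\<Sum>j<i. \<psi> r j (digit r x))"
  have "S (2 ^ r - 1 + i) = S (2 ^ r - 1) + B"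
    unfolding B_def by (rule step[OF assms])
  then have "\<bar>B\<bar> \<le> 2 * \<bar>S (2 ^ r - 1)\<bar> \<or> \<bar>B\<bar> \<le> 2 * \<bar>S (2 ^ r - 1 + i)\<bar>"
    by linarith
  moreover have "2 ^ r - 1 + i < 2 ^ Suc r" "2 ^ r - 1 < (2 :: nat) ^ Suc r"
    unfolding power_Suc using assms zero_less_power[of "2 :: nat" r] by linarith+
  ultimately show ?thesis unfolding S_def[symmetric] B_def[symmetric]
    by (metis le_add1 order_refl)
qed

end


section \<open>Distributing a divergent series over the blocks\<close>

text \<open>
  Once \<open>T q\<close> exceeds twice \<open>T p\<close>, the terms between \<open>p\<close> and \<open>q\<close>, even when all divided by the largest
  denominator \<open>T q\<close>, sum to at least \<open>1 / 2\<close>; this contradicts the Cauchy criterion.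
\<close>

lemma abel_dini:
  fixes t :: "nat \<Rightarrow> real"
  assumes nonneg: "\<And>r. 0 \<le> t r" and div: "\<not> summable t"
  defines "T \<equiv> \<lambda>r. \<Sum>i\<le>r. t i"
  shows "filterlim T at_top sequentially" and "\<not> summable (\<lambda>r. t r / T r)"
proof -
  have T_mono: "T p \<le> T q" if "p \<le> q" for p q
    unfolding T_def using that nonneg by (intro sum_mono2) auto
  have T_nonneg: "0 \<le> T p" for p
    unfolding T_def by (intro sum_nonneg nonneg)
  have unbounded: "\<exists>q. B < T q" for B
  proof (rule ccontr)
    assume "\<nexists>q. B < T q"
    then have "(\<Sum>i<q. t i) \<le> B" for q
    proof -
      have "(\<Sum>i<q. t i) \<le> T q"
        unfolding T_def using nonneg by (intro sum_mono2) auto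
      then show ?thesis using \<open>\<nexists>q. B < T q\<close> by (meson not_le order_trans)
    qed
    then have "summable t"
      using nonneg by (intro summableI_nonneg_bounded) auto
    with div show False by simp
  qed
  show lim: "filterlim T at_top sequentially"
    unfolding filterlim_at_top eventually_sequentially
    by (meson unbounded T_mono less_imp_le order_trans)
  show "\<not> summable (\<lambda>r. t r / T r)"
  proof
    assume "summable (\<lambda>r. t r / T r)"
    then obtain p where p: "\<And>m n. p \<le> m \<Longrightarrow> norm (\<Sum>r\<in>{m..<n}. t r / T r) < 1 / 2"
      unfolding summable_Cauchy by (meson half_gt_zero zero_less_one)
    obtain q where q: "2 * (T p + 1) < T q" using unbounded by blast
    have "p \<le> q"
      using T_mono[of q p] q T_nonneg[of p] by (cases "p \<le> q") auto
    have Tq: "0 < T q" using q T_nonneg[of p] by (simp add: less_trans[OF _ q])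
    have "1 / 2 \<le> (T q - T p) / T q"
      using q Tq by (simp add: field_simps)
    also have "\<dots> = (\<Sum>r\<in>{Suc p..<Suc q}. t r / T q)"
    proof -
      have "T q - T p = (\<Sum>r\<in>{Suc p..<Suc q}. t r)"
      proof -
        have "{Suc p..<Suc q} = {..q} - {..p}" by auto
        then show ?thesis unfolding T_def using \<open>p \<le> q\<close> by (simp only: sum_diff) (simp add: sum_diff)
      qed
      then show ?thesis by (simp only: sum_divide_distrib)
    qed
    also have "\<dots> \<le> (\<Sum>r\<in>{Suc p..<Suc q}. t r / T r)"
    proof (intro sum_mono)
      fix r assume "r \<in> {Suc p..<Suc q}"
      then have r: "T r \<le> T q" by (intro T_mono) auto
      show "t r / T q \<le> t r / T r"
      proof (cases "T r = 0")
        case True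
        have "t r \<le> T r" unfolding T_def by (intro member_le_sum) (auto simp: nonneg)
        then have "t r = 0" using True nonneg[of r] by simp
        then show ?thesis by simp
      next
        case False
        then show ?thesis using r T_nonneg[of r] nonneg[of r] Tq
          by (intro divide_left_mono) auto
      qed
    qed
    also have "\<dots> < 1 / 2" using p[of "Suc p" "Suc q"] by simp
    finally show False by simp
  qed
qed

text \<open>
  The last clause says that \<open>\<sigma> r\<close> is at most the term of the series divided by \<open>T r\<close>, cleared of
  denominators. The bound \<open>\<sigma> r \<le> 1\<close> allows \<open>\<sigma> r\<close> to be matched by a probability.
\<close>

lemma divergent_series_weights:
  assumes H: "normalization H" and div: "\<not> normalization_series_converges H"
  shows "\<exists>\<sigma> T :: nat \<Rightarrow> real. (\<forall>r. 0 \<le> \<sigma> r \<and> \<sigma> r \<le> 1)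
    \<and> \<not> summable \<sigma> \<and> filterlim T at_top sequentially
    \<and> (\<forall>r. \<sigma> r * T r * (H (2 ^ r))\<^sup>2 \<le> 2 ^ r * (real r)\<^sup>2)"
proof -
  define t where "t r = 2 ^ r * (real r)\<^sup>2 / (H (2 ^ r))\<^sup>2" for r
  define T where "T r = (\<Sum>i\<le>r. t i)" for r
  have t: "0 \<le> t r" for r by (simp add: t_def)
  have T: "0 \<le> T r" "t r \<le> T r" for r
    unfolding T_def by (auto intro: sum_nonneg t intro!: member_le_sum)
  have ndiv: "\<not> summable t"
    using div unfolding t_def normalization_series_converges_def .
  have lims: "filterlim T at_top sequentially" "\<not> summable (\<lambda>r. t r / T r)"
    using abel_dini[of t, OF t ndiv] unfolding T_def by auto
  have key: "t r / T r * T r * (H (2 ^ r))\<^sup>2 \<le> 2 ^ r * (real r)\<^sup>2" for r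
  proof -
    have H1: "1 \<le> H (2 ^ r)" by (intro normalization_pos[OF H]) simp
    have "t r / T r * T r \<le> t r" using t[of r] T[of r] by (cases "T r = 0") auto
    also have "\<dots> = 2 ^ r * (real r)\<^sup>2 / (H (2 ^ r))\<^sup>2" by (simp add: t_def)
    finally have "t r / T r * T r * (H (2 ^ r))\<^sup>2
        \<le> 2 ^ r * (real r)\<^sup>2 / (H (2 ^ r))\<^sup>2 * (H (2 ^ r))\<^sup>2"
      by (intro mult_right_mono) auto
    then show ?thesis using H1 by simp
  qed
  have "0 \<le> t r / T r \<and> t r / T r \<le> 1" for r
    using t[of r] T[of r] by (auto simp: divide_le_eq_1 less_le)
  then show ?thesis
    using lims key by (intro exI[of _ "\<lambda>r. t r / T r"] exI[of _ T]) blast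
qed

text \<open>
  The quotient \<open>2 ^ a / 2 ^ b\<close> is a power of \<open>1 / 2\<close> whose exponent must have the parity of \<open>r\<close>. Rounding to a power
  of \<open>1 / 2\<close> and adjusting the parity lose a factor \<open>2\<close> each. The lower bound on \<open>\<sigma>\<close> keeps \<open>b - a\<close> below
  about \<open>r / 2\<close> and therefore \<open>a\<close> comparable to \<open>r\<close>.
\<close>

lemma dyadic_split:
  fixes \<sigma> :: real
  assumes "(1 / 2) ^ (r div 2) \<le> \<sigma>" "\<sigma> \<le> 1"
  shows "\<exists>a b. a + b = r \<and> a \<le> b \<and> r \<le> 4 * a + 2
    \<and> \<sigma> / 4 \<le> 2 ^ a / 2 ^ b \<and> 2 ^ a / 2 ^ b \<le> \<sigma>"
proof -
  define e where "e = (LEAST e. (1 / 2) ^ e \<le> \<sigma>)"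
  have e: "(1 / 2) ^ e \<le> \<sigma>" "e \<le> r div 2"
    unfolding e_def using assms(1) by (rule LeastI, rule Least_le)
  have e_half: "\<sigma> / 2 \<le> (1 / 2) ^ e"
  proof (cases e)
    case (Suc d)
    then have "\<not> (1 / 2) ^ d \<le> \<sigma>"
      using not_less_Least[of d "\<lambda>e. (1 / 2) ^ e \<le> \<sigma>"] unfolding e_def by auto
    then show ?thesis using Suc by simp
  qed (use assms in auto)
  define e' where "e' = (if even (r - e) then e else Suc e)"
  have e'r: "e' \<le> r" "even (r - e')" "e' \<le> r div 2 + 1"
    using e(2) by (auto simp: e'_def) presburger+
  have e': "(1 / 2) ^ e' \<le> \<sigma>" "\<sigma> / 4 \<le> (1 / 2) ^ e'"
  proof -
    have "(1 / 2 :: real) ^ e' \<le> (1 / 2) ^ e" by (auto simp: e'_def)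
    then show "(1 / 2) ^ e' \<le> \<sigma>" using e(1) by (rule order_trans)
    have "(1 / 2 :: real) ^ e / 2 \<le> (1 / 2) ^ e'" by (auto simp: e'_def)
    then show "\<sigma> / 4 \<le> (1 / 2) ^ e'" using e_half by simp
  qed
  define a where "a = (r - e') div 2"
  have a: "2 * a = r - e'" using e'r by (simp add: a_def)
  have "(2 :: real) ^ a / 2 ^ (a + e') = (1 / 2) ^ e'"
    by (simp add: power_add power_divide)
  moreover have "a + (a + e') = r" using a e'r by linarith
  moreover have "r \<le> 4 * a + 2" using a e'r by linarith
  ultimately show ?thesis using e'
    by (intro exI[of _ a] exI[of _ "a + e'"]) simp
qed

text \<open>
  The values of \<open>r\<close> for which \<open>\<sigma>\<close> lies below the threshold of \<open>dyadic_split\<close> contribute only a convergent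
  part to the divergent sum of \<open>\<sigma>\<close>.
\<close>

lemma summable_half_power_div_2: "summable (\<lambda>r. (1 / 2 :: real) ^ (r div 2))"
proof (rule summable_comparison_test)
  show "summable (\<lambda>r. 4 / 3 * (3 / 4 :: real) ^ r)"
    by (intro summable_mult summable_geometric) simp
  have "(1 / 2 :: real) ^ (r div 2) \<le> 4 / 3 * (3 / 4) ^ r" for r
  proof -
    have "(1 / 2 :: real) ^ (r div 2) \<le> ((3 / 4)\<^sup>2) ^ (r div 2)"
      by (intro power_mono) (auto simp: power2_eq_square)
    also have "\<dots> = (3 / 4) ^ (2 * (r div 2))" by (simp add: power_mult)
    also have "\<dots> = 4 / 3 * (3 / 4) ^ Suc (2 * (r div 2))" by simp
    also have "\<dots> \<le> 4 / 3 * (3 / 4) ^ r"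
      by (intro mult_left_mono power_decreasing) auto
    finally show ?thesis .
  qed
  then show "\<exists>N. \<forall>r\<ge>N. norm ((1 / 2 :: real) ^ (r div 2)) \<le> 4 / 3 * (3 / 4) ^ r" by simp
qed

section \<open>Divergence of the series yields a bad system\<close>

lemma limsup_eq_PInfty_if_unbounded:
  fixes u :: "nat \<Rightarrow> real"
  assumes "\<And>C N0. \<exists>N\<ge>N0. C \<le> u N"
  shows "limsup (\<lambda>N. ereal (u N)) = \<infinity>"
proof (rule ccontr)
  assume "limsup (\<lambda>N. ereal (u N)) \<noteq> \<infinity>"
  then obtain n where "limsup (\<lambda>N. ereal (u N)) < ereal (real n)"
    using less_PInf_Ex_of_nat by blast
  then have "\<forall>\<^sub>F N in sequentially. ereal (u N) < ereal (real n)"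
    by (rule Limsup_lessD)
  then obtain N0 where "\<And>N. N0 \<le> N \<Longrightarrow> u N < real n"
    unfolding eventually_sequentially by auto
  then show False using assms[of N0 "real n"] by (meson not_le)
qed

lemma not_bigo_if_ratio_unbounded:
  fixes u v :: "nat \<Rightarrow> real"
  assumes unbounded: "\<And>C N0. \<exists>N\<ge>N0. C \<le> \<bar>u N\<bar> / v N" and pos: "\<forall>\<^sub>F N in sequentially. 0 < v N"
  shows "u \<notin> O(v)"
proof
  assume "u \<in> O(v)"
  then obtain c where "\<forall>\<^sub>F N in sequentially. norm (u N) \<le> c * norm (v N)"
    by (rule landau_o.bigE)
  with pos have "\<forall>\<^sub>F N in sequentially. \<bar>u N\<bar> / v N < c + 1"
    by eventually_elim (simp add: divide_less_eq distrib_right)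
  then obtain N0 where "\<And>N. N0 \<le> N \<Longrightarrow> \<bar>u N\<bar> / v N < c + 1"
    unfolding eventually_sequentially by auto
  then show False using unbounded[of N0 "c + 1"] by (meson not_le)
qed

text \<open>
  The block \<open>r\<close> ends just before the index \<open>2 ^ Suc r\<close> and has to compete with \<open>H (2 ^ Suc r)\<close>, which is why
  \<open>\<sigma>\<close> is taken at \<open>Suc r\<close>.
\<close>

lemma block_choice:
  fixes \<sigma> :: "nat \<Rightarrow> real"
  assumes "\<And>r. \<sigma> r \<le> 1"
  shows "\<exists>\<alpha> \<beta> :: nat \<Rightarrow> nat. \<forall>r. \<alpha> r + \<beta> r = r \<and> \<alpha> r \<le> \<beta> r
    \<and> ((1 / 2) ^ (r div 2) \<le> \<sigma> (Suc r) \<longrightarrow> r \<le> 4 * \<alpha> r + 2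
      \<and> \<sigma> (Suc r) / 4 \<le> 2 ^ \<alpha> r / 2 ^ \<beta> r \<and> 2 ^ \<alpha> r / 2 ^ \<beta> r \<le> \<sigma> (Suc r))"
proof -
  define P where "P r a b \<longleftrightarrow> a + b = r \<and> a \<le> b \<and> ((1 / 2) ^ (r div 2) \<le> \<sigma> (Suc r) \<longrightarrow> r \<le> 4 * a + 2
      \<and> \<sigma> (Suc r) / 4 \<le> 2 ^ a / 2 ^ b \<and> 2 ^ a / 2 ^ b \<le> \<sigma> (Suc r))" for r a b
  have "\<exists>a b. P r a b" for r
  proof (cases "(1 / 2) ^ (r div 2) \<le> \<sigma> (Suc r)")
    case True
    then show ?thesis using dyadic_split[OF True assms] by (simp add: P_def)
  next
    case False
    then show ?thesis by (intro exI[of _ 0] exI[of _ r]) (simp add: P_def)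
  qed
  then obtain \<alpha> where "\<And>r. \<exists>b. P r (\<alpha> r) b"
    by (metis (no_types))
  then obtain \<beta> where "\<And>r. P r (\<alpha> r) (\<beta> r)"
    by (metis (no_types))
  then show ?thesis unfolding P_def by blast
qed

text \<open>
  On its event, the block \<open>r\<close> has a partial sum of order \<open>r * 2 ^ \<beta> r\<close>. Since
  \<open>(2 ^ \<beta> r)\<^sup>2 = 2 ^ r * (2 ^ \<beta> r / 2 ^ \<alpha> r)\<close> and \<open>2 ^ \<alpha> r / 2 ^ \<beta> r \<le> \<sigma> (Suc r)\<close>, the bound on
  \<open>\<sigma> * T * H\<^sup>2\<close> turns this into a multiple of \<open>H (2 ^ Suc r) * sqrt (T (Suc r))\<close>.
\<close>

lemma divergence_witness:
  assumes H: "normalization H" and div: "\<not> normalization_series_converges H"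
  obtains \<psi> where "block_system \<psi>"
    "AE x in unit_interval. \<forall>C N0. \<exists>N\<ge>N0. C \<le>
      \<bar>\<Sum>k=1..N. block_system.deviation \<psi> k x\<bar> / upper_bound_term H (\<lambda>_. 1 / 2) (\<lambda>_. 1) N"
proof -
  obtain \<sigma> T :: "nat \<Rightarrow> real"
    where \<sigma>_bounds: "\<forall>r. 0 \<le> \<sigma> r \<and> \<sigma> r \<le> 1" and \<sigma>_div: "\<not> summable \<sigma>"
      and T: "filterlim T at_top sequentially"
      and \<sigma>T: "\<forall>r. \<sigma> r * T r * (H (2 ^ r))\<^sup>2 \<le> 2 ^ r * (real r)\<^sup>2"
    using divergent_series_weights[OF H div] by (elim exE conjE)
  have \<sigma>: "0 \<le> \<sigma> r" "\<sigma> r \<le> 1" for r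
    using \<sigma>_bounds by auto
  obtain \<alpha> \<beta> where choice: "\<forall>r. \<alpha> r + \<beta> r = r \<and> \<alpha> r \<le> \<beta> r
    \<and> ((1 / 2) ^ (r div 2) \<le> \<sigma> (Suc r) \<longrightarrow> r \<le> 4 * \<alpha> r + 2
      \<and> \<sigma> (Suc r) / 4 \<le> 2 ^ \<alpha> r / 2 ^ \<beta> r \<and> 2 ^ \<alpha> r / 2 ^ \<beta> r \<le> \<sigma> (Suc r))"
    using block_choice[of \<sigma>] \<sigma>(2) by meson
  have ab: "\<alpha> r + \<beta> r = r" "\<alpha> r \<le> \<beta> r" for r
    using choice by auto
  have good: "r \<le> 4 * \<alpha> r + 2 \<and> \<sigma> (Suc r) / 4 \<le> 2 ^ \<alpha> r / 2 ^ \<beta> r \<and> 2 ^ \<alpha> r / 2 ^ \<beta> r \<le> \<sigma> (Suc r)"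
    if "(1 / 2) ^ (r div 2) \<le> \<sigma> (Suc r)" for r
    using choice that by blast
  define \<psi> where "\<psi> r = block (\<alpha> r) (\<beta> r)" for r
  interpret block_system \<psi>
  proof
    show "\<bar>\<psi> r i d\<bar> \<le> 1 / 2" for r i d
      unfolding \<psi>_def by (rule abs_block_le)
    show "(\<Sum>d<2 ^ (r + 2). \<psi> r i d) = 0" for r i
      using sum_block_eq_0[of "\<alpha> r" "\<beta> r" i] unfolding ab \<psi>_def .
    show "(\<Sum>d<2 ^ (r + 2). \<psi> r i d * \<psi> r j d) = (if i = j then 2 ^ (r + 2) / 8 else 0)"
      if "i < 2 ^ r" "j < 2 ^ r" for r i j
      using block_gram[OF ab(2)[of r], of i j] that unfolding ab \<psi>_def .
  qed
  \<comment> \<open>from \<open>r = 12\<close> on, \<open>r \<le> 4 * \<alpha> r + 2\<close> gives \<open>\<alpha> r - 1 \<ge> (r + 1) / 9\<close>\<close>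
  define G where "G r = (if 12 \<le> r \<and> (1 / 2) ^ (r div 2) \<le> \<sigma> (Suc r)
    then block_event (\<alpha> r) (\<beta> r) else {})" for r
  have "\<not> summable (\<lambda>r. real (card (G r)) / 2 ^ (r + 2))"
  proof
    let ?P = "\<lambda>r. real (card (G r)) / 2 ^ (r + 2)"
    assume "summable ?P"
    then have "summable (\<lambda>r. 16 * ?P r + (1 / 2) ^ (r div 2))"
      by (intro summable_add summable_mult summable_half_power_div_2)
    moreover have "\<forall>\<^sub>F r in sequentially. norm (\<sigma> (Suc r)) \<le> 16 * ?P r + (1 / 2) ^ (r div 2)"
      using eventually_ge_at_top[of 12]
    proof eventually_elim
      case (elim r)
      show ?case
      proof (cases "(1 / 2) ^ (r div 2) \<le> \<sigma> (Suc r)")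
        case True
        have "1 \<le> \<alpha> r" using good[OF True] elim by linarith
        define \<rho> :: real where "\<rho> = 2 ^ \<alpha> r / 2 ^ \<beta> r"
        have "?P r = \<rho> / 4"
          using card_block_event[OF \<open>1 \<le> \<alpha> r\<close> ab(2)] ab(1)[of r] True elim by (simp add: G_def \<rho>_def)
        moreover have "\<sigma> (Suc r) / 4 \<le> \<rho>" using good[OF True] by (simp add: \<rho>_def)
        ultimately have "\<sigma> (Suc r) \<le> 16 * ?P r" by linarith
        moreover have "0 \<le> (1 / 2 :: real) ^ (r div 2)" by simp
        ultimately show ?thesis using \<sigma>(1)[of "Suc r"] by (simp only: real_norm_def)
      next
        case False
        moreover have "0 \<le> 16 * ?P r" by simp
        ultimately show ?thesis using \<sigma>(1)[of "Suc r"] by (simp only: real_norm_def)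
      qed
    qed
    ultimately have "summable (\<lambda>r. \<sigma> (Suc r))"
      by (rule summable_comparison_test_ev[rotated])
    then show False using \<sigma>_div by (simp add: summable_Suc_iff)
  qed
  moreover have "G r \<subseteq> {..<2 ^ (r + 2)}" for r
    using ab(1)[of r] by (auto simp: G_def block_event_def)
  ultimately have "AE x in unit_interval. \<exists>\<^sub>\<infinity>r. digit r x \<in> G r"
    by (intro digits_hit_infinitely_often)
  then have "AE x in unit_interval. \<forall>C N0. \<exists>N\<ge>N0. C \<le>
      \<bar>\<Sum>k=1..N. deviation k x\<bar> / upper_bound_term H (\<lambda>_. 1 / 2) (\<lambda>_. 1) N"
  proof (rule AE_mp, intro AE_I2 impI allI)
    fix x C :: real and N0 :: nat assume often: "\<exists>\<^sub>\<infinity>r. digit r x \<in> G r"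
    \<comment> \<open>\<open>648 = 12 * 2 * 9 * 3\<close>: the constant of \<open>block_event_large_sum\<close>, the loss in
        \<open>block_sum_le_partial_sum\<close>, the comparison of \<open>\<alpha> r - 1\<close> with \<open>r + 1\<close>, and \<open>U \<le> 3 * h\<close>\<close>
    define c where "c = 648 * max C 0"
    have "\<forall>\<^sub>F r in sequentially. 2 * c\<^sup>2 \<le> T r"
      using T unfolding filterlim_at_top by blast
    then obtain r0 where r0: "\<And>r. r0 \<le> r \<Longrightarrow> 2 * c\<^sup>2 \<le> T r"
      unfolding eventually_sequentially by blast
    obtain r where r: "max r0 (Suc N0) \<le> r" "digit r x \<in> G r"
      using often unfolding INFM_nat_le by blast
    then have r12: "12 \<le> r" and event: "digit r x \<in> block_event (\<alpha> r) (\<beta> r)"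
      and \<alpha>: "r \<le> 4 * \<alpha> r + 2" and ratio: "2 ^ \<alpha> r / 2 ^ \<beta> r \<le> \<sigma> (Suc r)"
      using good[of r] by (auto simp: G_def split: if_splits)
    have \<alpha>1: "1 \<le> \<alpha> r" using \<alpha> r12 by linarith
    define h where "h = H (2 ^ Suc r)"
    have h: "1 \<le> h" unfolding h_def by (intro normalization_pos[OF H]) (simp del: power_Suc)
    obtain i where i: "i \<le> 2 ^ r"
      and big: "2 ^ \<beta> r * (real (\<alpha> r) - 1) / 12 \<le> \<bar>\<Sum>j<i. \<psi> r j (digit r x)\<bar>"
      using block_event_large_sum[OF \<alpha>1 event] ab(1)[of r] unfolding \<psi>_def by auto
    obtain N where N: "2 ^ r - 1 \<le> N" "N < 2 ^ Suc r"
      and N_big: "\<bar>\<Sum>j<i. \<psi> r j (digit r x)\<bar> \<le> 2 * \<bar>\<Sum>k=1..N. deviation k x\<bar>"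
      using block_sum_le_partial_sum[OF i] by blast
    have ch: "c * h \<le> 2 ^ \<beta> r * real (Suc r)"
    proof -
      have "2 ^ \<alpha> r / 2 ^ \<beta> r * (2 * c\<^sup>2) * h\<^sup>2 \<le> \<sigma> (Suc r) * T (Suc r) * h\<^sup>2"
        using ratio r0[of "Suc r"] r(1) \<sigma>(1) by (intro mult_right_mono mult_mono) auto
      also have "\<dots> \<le> 2 ^ Suc r * (real (Suc r))\<^sup>2"
        unfolding h_def using \<sigma>T by blast
      also have "(2 :: real) ^ Suc r = 2 * (2 ^ \<alpha> r * 2 ^ \<beta> r)"
        using ab(1)[of r] by (simp flip: power_add)
      finally have "2 * 2 ^ \<alpha> r / 2 ^ \<beta> r * (c * h)\<^sup>2
          \<le> 2 * 2 ^ \<alpha> r / 2 ^ \<beta> r * (2 ^ \<beta> r * real (Suc r))\<^sup>2"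
        by (simp add: power_mult_distrib power2_eq_square mult_ac)
      then have "(c * h)\<^sup>2 \<le> (2 ^ \<beta> r * real (Suc r))\<^sup>2"
        by (subst (asm) mult_le_cancel_left_pos) simp_all
      then show ?thesis by (rule power2_le_imp_le) simp
    qed
    define X where "X = 2 ^ \<beta> r * (real (\<alpha> r) - 1)"
    have "2 ^ \<beta> r * (real (Suc r) / 9) \<le> 2 ^ \<beta> r * (real (\<alpha> r) - 1)"
    proof (intro mult_left_mono)
      have "real r \<le> real (4 * \<alpha> r + 2)"
        using \<alpha> by (simp only: of_nat_le_iff)
      moreover have "12 \<le> real r" using r12 by simp
      ultimately show "real (Suc r) / 9 \<le> real (\<alpha> r) - 1" by simp
    qed simp
    then have "2 ^ \<beta> r * real (Suc r) \<le> 9 * X"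
      by (simp add: X_def mult.assoc)
    with ch have "c * h \<le> 9 * X" by (rule order_trans)
    moreover have "X / 12 \<le> \<bar>\<Sum>j<i. \<psi> r j (digit r x)\<bar>"
      using big unfolding X_def .
    ultimately have D: "c * h / 216 \<le> \<bar>\<Sum>k=1..N. deviation k x\<bar>"
      using N_big by linarith
    have "Suc 0 \<le> N" "N0 \<le> N"
    proof -
      have "Suc r \<le> 2 ^ r" by (rule Suc_leI[OF less_exp])
      then show "Suc 0 \<le> N" "N0 \<le> N" using N(1) r(1) r12 by linarith+
    qed
    define U where "U = upper_bound_term H (\<lambda>_. 1 / 2) (\<lambda>_. 1) N"
    have U: "0 < U" "U \<le> 3 * h"
    proof -
      have "(\<lambda>_. 1 / 2 :: real) ` {1..N} = {1 / 2}" using \<open>Suc 0 \<le> N\<close> by auto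
      then have eq: "U = H (real N + 1) + 3 / 2"
        unfolding U_def upper_bound_term_def Phi_def by simp
      have "real (Suc N) \<le> real (2 ^ Suc r)" using N(2) by (simp only: of_nat_le_iff Suc_le_eq)
      then have "H (real N + 1) \<le> h"
        unfolding h_def by (intro normalization_mono[OF H]) (simp_all add: add.commute)
      moreover have "1 \<le> H (real N + 1)" by (intro normalization_pos[OF H]) simp
      ultimately show "0 < U" "U \<le> 3 * h" using h unfolding eq by linarith+
    qed
    have "C * U \<le> max C 0 * (3 * h)"
      using U by (intro mult_mono) auto
    also have "\<dots> = c * h / 216" by (simp add: c_def)
    finally have "C \<le> \<bar>\<Sum>k=1..N. deviation k x\<bar> / U"
      using D U by (simp add: pos_le_divide_eq)
    then show "\<exists>N\<ge>N0. C \<le> \<bar>\<Sum>k=1..N. deviation k x\<bar> / upper_bound_term H (\<lambda>_. 1 / 2) (\<lambda>_. 1) N"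
      using \<open>N0 \<le> N\<close> unfolding U_def by blast
  qed
  then show ?thesis by (intro that[of \<psi>] block_system_axioms)
qed

theorem universal_upper_class_if_series_converges:
  assumes "normalization H" "normalization_series_converges H"
  shows "universal_upper_class TYPE('a) H"
  unfolding universal_upper_class_def
  using assms admissible_system.upper_class_if_series_converges by blast

theorem theorem1:
  fixes H :: "real \<Rightarrow> real"
  assumes "normalization H"
  shows "(universal_upper_class TYPE(real) H \<longleftrightarrow> normalization_series_converges H)
    \<and> (normalization_series_converges H \<longrightarrow> universal_upper_class TYPE('a) H)
    \<and> (\<not> normalization_series_converges H \<longrightarrow>
        (\<exists>(F :: nat \<Rightarrow> real \<Rightarrow> real) f g.
            (\<forall>k\<ge>1. f k = 1 / 2) \<and> (\<forall>k\<ge>1. g k = 1)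
          \<and> admissible_system unit_interval F f g
          \<and> \<not> upper_class_for H unit_interval F f g
          \<and> (\<forall>k\<ge>1. (\<forall>x\<in>{0..1}. 0 \<le> F k x \<and> F k x \<le> 1)
               \<and> f k = (\<integral>x. F k x \<partial>unit_interval))
          \<and> (\<exists>K>0. \<forall>m n. 1 \<le> m \<and> m < n \<longrightarrow>
               (\<integral>x. (\<Sum>k\<in>{m<..n}. F k x - f k)\<^sup>2 \<partial>unit_interval) = K * (real n - real m))
          \<and> (AE x in unit_interval.
               limsup (\<lambda>N. ereal (\<bar>Disc F f N x\<bar> / upper_bound_term H f g N)) = \<infinity>)))"
proof -
  have witness: "\<exists>(F :: nat \<Rightarrow> real \<Rightarrow> real) f g.
            (\<forall>k\<ge>1. f k = 1 / 2) \<and> (\<forall>k\<ge>1. g k = 1)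
          \<and> admissible_system unit_interval F f g
          \<and> \<not> upper_class_for H unit_interval F f g
          \<and> (\<forall>k\<ge>1. (\<forall>x\<in>{0..1}. 0 \<le> F k x \<and> F k x \<le> 1)
               \<and> f k = (\<integral>x. F k x \<partial>unit_interval))
          \<and> (\<exists>K>0. \<forall>m n. 1 \<le> m \<and> m < n \<longrightarrow>
               (\<integral>x. (\<Sum>k\<in>{m<..n}. F k x - f k)\<^sup>2 \<partial>unit_interval) = K * (real n - real m))
          \<and> (AE x in unit_interval.
               limsup (\<lambda>N. ereal (\<bar>Disc F f N x\<bar> / upper_bound_term H f g N)) = \<infinity>)"
    if div: "\<not> normalization_series_converges H"
  proof -
    obtain \<psi> where "block_system \<psi>" and unbounded:
      "AE x in unit_interval. \<forall>C N0. \<exists>N\<ge>N0. C \<le>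
        \<bar>\<Sum>k=1..N. block_system.deviation \<psi> k x\<bar> / upper_bound_term H (\<lambda>_. 1 / 2) (\<lambda>_. 1) N"
      using divergence_witness[OF assms div] by blast
    interpret block_system \<psi> by fact
    define F where "F k x = 1 / 2 + deviation k x" for k x
    define f where "f = (\<lambda>_ :: nat. 1 / 2 :: real)"
    define g where "g = (\<lambda>_ :: nat. 1 :: real)"
    have Disc: "Disc F f N x = (\<Sum>k=1..N. deviation k x)" for N x
      unfolding F_def f_def by (rule Disc_deviation)
    have unbounded: "AE x in unit_interval. \<forall>C N0. \<exists>N\<ge>N0. C \<le>
        \<bar>Disc F f N x\<bar> / upper_bound_term H f g N"
      using unbounded unfolding Disc unfolding f_def g_def .
    have admissible: "admissible_system unit_interval F f g"
      unfolding F_def f_def g_def by (rule admissible_system_deviation)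
    have pos: "\<forall>\<^sub>F N in sequentially. 0 < upper_bound_term H f g N"
      using eventually_ge_at_top[of 1]
    proof eventually_elim
      case (elim N)
      then have "f ` {1..N} = {1 / 2}" by (auto simp: f_def)
      moreover have "1 \<le> H (real N + 1)" by (intro normalization_pos[OF assms]) simp
      ultimately show ?case by (simp add: upper_bound_term_def Phi_def g_def)
    qed
    have "\<not> upper_class_for H unit_interval F f g"
    proof
      assume "upper_class_for H unit_interval F f g"
      then have "AE x in unit_interval. (\<lambda>N. Disc F f N x) \<in> O(\<lambda>N. upper_bound_term H f g N)"
        unfolding upper_class_for_def .
      with unbounded have "AE x in unit_interval. False"
      proof eventually_elim
        case (elim x)
        have "(\<lambda>N. Disc F f N x) \<notin> O(\<lambda>N. upper_bound_term H f g N)"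
          by (rule not_bigo_if_ratio_unbounded[OF _ pos]) (use elim(1) in blast)
        then show False using elim(2) by contradiction
      qed
      then have "emeasure unit_interval (space unit_interval) = 0"
        by (simp only: eventually_False ae_filter_eq_bot_iff)
      then show False unfolding emeasure_unit_interval by simp
    qed
    moreover have "\<forall>k\<ge>1. (\<forall>x\<in>{0..1}. 0 \<le> F k x \<and> F k x \<le> 1) \<and> f k = (\<integral>x. F k x \<partial>unit_interval)"
    proof (intro allI impI conjI ballI)
      fix k :: nat and x :: real
      show "0 \<le> F k x" "F k x \<le> 1"
        using abs_deviation_le[of k x] unfolding F_def by linarith+
      have "has_bochner_integral unit_interval (\<lambda>x. 1 / 2 :: real) (1 / 2)"
        using has_integral_leading_bits[of "\<lambda>_. 1 / 2" 0] by simp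
      from has_bochner_integral_add[OF this has_integral_deviation[of k]]
      show "f k = (\<integral>x. F k x \<partial>unit_interval)"
        unfolding F_def f_def by (simp add: has_bochner_integral_integral_eq)
    qed
    moreover have "\<exists>K>0. \<forall>m n. 1 \<le> m \<and> m < n \<longrightarrow>
        (\<integral>x. (\<Sum>k\<in>{m<..n}. F k x - f k)\<^sup>2 \<partial>unit_interval) = K * (real n - real m)"
      using has_bochner_integral_integral_eq[OF has_integral_deviation_sum_square]
      by (intro exI[of _ "1 / 8"]) (simp add: F_def f_def)
    moreover have "AE x in unit_interval.
        limsup (\<lambda>N. ereal (\<bar>Disc F f N x\<bar> / upper_bound_term H f g N)) = \<infinity>"
      using unbounded by eventually_elim (rule limsup_eq_PInfty_if_unbounded, blast)
    ultimately show ?thesis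
      using admissible by (intro exI[of _ F] exI[of _ f] exI[of _ g]) (simp add: f_def g_def)
  qed
  show ?thesis
  proof (intro conjI impI iffI)
    assume universal: "universal_upper_class TYPE(real) H"
    show "normalization_series_converges H"
    proof (rule ccontr)
      assume "\<not> normalization_series_converges H"
      from witness[OF this] universal show False
        unfolding universal_upper_class_def by blast
    qed
  qed (fact universal_upper_class_if_series_converges[OF assms] witness)+
qed

end
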